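(* Let $\Gamma$ be a weighted quiver without (undirected) cycles and without flavor nodes. Then the quantum cluster $\mathcal A$-variables $Y_\xi$, $\xi\in\Pi_\Gamma^\vee$, defined by the compatible pair $(\Pi_\Gamma,\Pi_\Gamma^\vee)$ consist of dressed minuscule monopole operators in $\mathscr A_\Gamma$: under the isomorphism $\mathbb W_\Gamma\colon\mathbb L_{\Pi_\Gamma}\simeq\mathscr A_\Gamma$, each $\mathbb W_\Gamma(Y_\xi)$ with $\xi\in\Pi_\Gamma^\vee$ equals, up to multiplication by an integer power of $q$, one of the operators $E_{\mathbf n,\mathbf f}$ or $F_{\mathbf n,\mathbf f}$.
   Context: $\Gamma$ is a finite quiver with nodes $\Gamma_0$ (all gauge nodes), arrows $\Gamma_1$, each node $i$ carrying a complex vector space $V_i$ of dimension $d_i\ge1$; its underlying graph is a forest. **Lattice and seed.** $\Lambda_{|\Gamma|}$ is the free abelian group with basis $p_{i,m},x_{i,m}$ ($i\in\Gamma_0$, $1\le m\le d_i$), with skew form $(p_{i,m},x_{j,n})=\delta_{ij}\delta_{mn}=-(x_{j,n},p_{i,m})$, other pairings of basis vectors zero. Put $p_{\varpi_{i,m}}=\sum_{r\le m}p_{i,r}$, $x_{\varpi_{i,m}}=\sum_{r\le m}x_{i,r}$. The seed $\Pi_\Gamma$ consists of $e_{s_{i,m}}=x_{i,m+1}-x_{i,m}$, $e_{t_{i,m}}=p_{i,m}-p_{i,m+1}+x_{i,m}-x_{i,m+1}$ ($1\le m<d_i$), and $e_a=p_{j,d_j}-p_{i,1}$ for each arrow $a\colon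 i\to j$. **The dual basis.** Choose a root in each connected component; let $\Gamma^\dagger_{\ge i}$ be the set consisting of $i$ and its descendants. $\mathrm{sgn}(i)=1$ if $i$ is a root or receives an arrow from its parent, $-1$ otherwise; $\mathrm{sgn}(a)=1$ if $a$ points from parent to child, $-1$ otherwise. Put $\rho(i)=\sum_{a:i\to j}\sum_{k\in\Gamma^\dagger_{\ge j}}x_{\varpi_{k,d_k}}$ if $\mathrm{sgn}(i)=1$ and $\rho(i)=-x_{\varpi_{i,d_i}}-\sum_{a:j\to i}\sum_{k\in\Gamma^\dagger_{\ge j}}x_{\varpi_{k,d_k}}$ if $\mathrm{sgn}(i)=-1$. $\Pi_\Gamma^\vee$ consists of $\xi_{t_{i,m}}=x_{\varpi_{i,m}}+\rho(i)$, $\xi_{s_{i,m}}=p_{\varpi_{i,m}}+x_{\varpi_{i,m}}-p_{\varpi_{i,d_i}}+\rho(i)$ ($1\le m<d_i$), $\xi_i=-p_{\varpi_{i,d_i}}$ ($i\in\Gamma_0$), for each component $C$ the vector $\xi_{\bullet}=\sum_{i\in C}x_{\varpi_{i,d_i}}$, and for each arrow $a\colon i\to j$ the vector $\xi_a=\sum_{k\in\Gamma^\dagger_{\ge j}}x_{\varpi_{k,d_k}}$ if $\mathrm{sgn}(a)=1$, $\xi_a=-\sum_{k\in\Gamma^\dagger_{\ge i}}x_{\varpi_{k,d_k}}$ if $\mathrm{sgn}(a)=-1$. **Quantum torus and Laurent algebra.** $\mathbb T_\Lambda$ is the $\mathbb Z[q^{\pm1}]$-algebra with basis $\{Y_\lambda\}_{\lambda\in\Lambda}$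 and $(-q)^{(\lambda,\mu)}Y_\lambda Y_\mu=Y_{\lambda+\mu}$. With $\Psi(X)=\prod_{n\ge0}(1-q^{2n+1}X)^{-1}$ and $\mathrm{Ad}_x(y)=xyx^{-1}$, the quantum universally Laurent algebra $\mathbb L_\Pi$ of a seed $\Pi$ (the algebra of elements Laurent in all mutation-equivalent seeds) equals $\{A\in\mathbb T_\Lambda\mid \mathrm{Ad}_{\Psi(Y_{-e})}(A)\in\mathbb T_\Lambda\ \forall e\in\Pi\}$. It contains all $Y_\xi$ with $(e,\xi)\ge0$ for all $e\in\Pi$. The cluster $\mathcal A$-variables of a compatible pair $(\Pi,\Pi^\vee)$ are the $Y_\xi$, $\xi\in\Pi^\vee$. **Coulomb branch.** $\mathcal D_{\mathrm{loc}}(T_d)$ is the $\mathbb Z[q^{\pm1}]$-algebra generated by commuting $w_r^{\pm1}$ and commuting $D_r^{\pm1}$ ($1\le r\le d$), $D_rw_s=q^{2\delta_{rs}}w_sD_r$, localized at all $1-q^{2k}w_\alpha$, $k\in\mathbb Z$, $\alpha=\epsilon_r-\epsilon_s$ ($r<s$), $w_\alpha=w_r/w_s$. $\mathcal D_{\mathrm{res}}(T_d)$ is the subalgebra of $S_d$-invariant finite sums $\sum_\mu h_\mu D_\mu$ such that each $h_\mu$ has at most a simple pole along each $\{q^{2k}w_\alpha=1\}$ and the residues of $h_\mu$ and $h_{s_\alpha(\mu)+k\alpha}$ there sum to zero. The pure $GL_d$ Coulomb branch is $\mathscr A_{GL_d,0}=\mathcal D_{\mathrm{res}}(T_d)$.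 The quantized $K$-theoretic Coulomb branch $\mathscr A_\Gamma$ of the quiver gauge theory (gauge group $G_V=\prod_iGL(V_i)$, representation $\bigoplus_{a:i\to j}\mathrm{Hom}(V_i,V_j)$, no flavor torus) is, via localization, the subalgebra of $\bigotimes_{i\in\Gamma_0}\mathcal D_{\mathrm{res}}(T_{d_i})$ (variables $w_{i,r},D_{i,r}$) generated over $\mathbb Z[q^{\pm1}][w_{i,r}^{\pm1}]^{\prod S_{d_i}}$ by the dressed minuscule monopole operators $$E_{\mathbf n,\mathbf f}=\sum_{\mathbf J}\prod_{a:i\to j}\prod_{r\in J_i,s\notin J_j}(1-qw_{i,r}w_{j,s}^{-1})\prod_lf_l(w)\prod_{r\in J_l,s\notin J_l}\frac1{1-w_{l,s}w_{l,r}^{-1}}\prod_{r\in J_l}D_{l,r},$$ $$F_{\mathbf n,\mathbf f}=\sum_{\mathbf J}\prod_{a:j\to i}\prod_{r\in J_i,s\notin J_j}(1-qw_{j,s}w_{i,r}^{-1})\prod_lf_l(w)\prod_{r\in J_l,s\notin J_l}\frac1{1-w_{l,r}w_{l,s}^{-1}}\prod_{r\in J_l}D_{l,r}^{-1},$$ for $\mathbf n=(n_l)_{l\in\Gamma_0}$ with $0\le n_l\le d_l$ and Laurent polynomials $f_l$ symmetric under $S_{n_l}\times S_{d_l-n_l}$; sums are over $\mathbf J=(J_l)$, $J_l\subset\{1,\dots,d_l\}$, $|J_l|=n_l$, and $f_l$ is evaluated at $(w_{l,r})_{r\in J_l},(w_{l,s})_{s\notin J_l}$. **Isomorphism.** For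 one node of dimension $d$ put $P_\lambda=Y_{\sum\lambda_ip_i}$, $X_\lambda=Y_{\sum\lambda_ix_i}$, $\varpi_n=\epsilon_1+\dots+\epsilon_n$, $\alpha_m=\epsilon_m-\epsilon_{m+1}$, $H_n=\sum_{|I|=n}P_{\sum_{i\in I}\epsilon_i}\prod_{m\notin I,m+1\in I}(1-qX_{-\alpha_m})$, and let $\mathbb L_{GL_d,0}$ be the universally Laurent algebra of the seed $\{e_{s_m},e_{t_m}\}_{m<d}$. There is a unique algebra isomorphism $\mathbb W\colon\mathbb L_{GL_d,0}\to\mathscr A_{GL_d,0}$ with, for $1\le n\le d$, $\mathbb W(H_n)=e_n(w)$, $\mathbb W(X_{\varpi_n})=q^{-n(n-1)/2}\sum_{|J|=n}\prod_{r\in J,s\notin J}\frac1{1-w_s/w_r}\prod_{j\in J}D_j$, $\mathbb W(Y_{\sum_{i\le n}(p_i+x_i)})=(-q)^nq^{-n(n-1)/2}\sum_{|J|=n}\prod_{r\in J,s\notin J}\frac1{1-w_s/w_r}\prod_{j\in J}w_jD_j$. $\mathbb W_\Gamma=\bigotimes_{i\in\Gamma_0}\mathbb W$, and it is known to restrict to an isomorphism $\mathbb L_{\Pi_\Gamma}\simeq\mathscr A_\Gamma$. *)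

theory Defs
  imports
    "HOL-Library.Poly_Mapping"
    "HOL-Library.Product_Lexorder"
    "HOL-Library.FuncSet"
    "HOL-Combinatorics.Permutations"
    "HOL-Computational_Algebra.Formal_Laurent_Series"
    "HOL-Computational_Algebra.Fraction_Field"
    "HOL-Algebra.QuotRing"
    "HOL-Algebra.Generated_Rings"
    "HOL-Algebra.Free_Abelian_Groups"
    "Graph_Theory.Arc_Walk"
begin

section \<open>Quivers, forests and rooted orders\<close>

text \<open>A quiver is a \<open>pre_digraph\<close>. Its underlying undirected multigraph is encoded by letting every
  arrow \<open>a\<close> be traversed forwards, as \<open>(a, True)\<close>, or backwards, as \<open>(a, False)\<close>.\<close>

definition undirected :: "('v, 'a) pre_digraph \<Rightarrow> ('v, 'a \<times> bool) pre_digraph" where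
  "undirected G = \<lparr>verts = verts G, arcs = arcs G \<times> UNIV,
     tail = (\<lambda>(a, b). if b then tail G a else head G a),
     head = (\<lambda>(a, b). if b then head G a else tail G a)\<rparr>"

text \<open>An undirected cycle may not use an arrow twice; loops and pairs of parallel or opposite arrows
  are cycles.\<close>

definition undirected_forest :: "('v, 'a) pre_digraph \<Rightarrow> bool" where
  "undirected_forest G \<longleftrightarrow>
     \<not> (\<exists>p. pre_digraph.cycle (undirected G) p \<and> distinct (map fst p))"

definition component_of :: "('v, 'a) pre_digraph \<Rightarrow> 'v \<Rightarrow> 'v set" where
  "component_of G i = {j. \<exists>p. pre_digraph.awalk (undirected G) i p j}"

definition root_choice :: "('v, 'a) pre_digraph \<Rightarrow> 'v set \<Rightarrow> bool" where
  "root_choice G R \<longleftrightarrow> R \<subseteq> verts G \<and> (\<forall>i \<in> verts G. \<exists>!r. r \<in> R \<and> r \<in> component_of G i)"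

text \<open>\<open>descendants G R i\<close> contains \<open>i\<close> itself: it is the set of nodes \<open>k\<close> such that \<open>i\<close> lies on the
  path from the root to \<open>k\<close>.\<close>

definition descendants :: "('v, 'a) pre_digraph \<Rightarrow> 'v set \<Rightarrow> 'v \<Rightarrow> 'v set" where
  "descendants G R i = {k. \<exists>r \<in> R. \<exists>p. pre_digraph.apath (undirected G) r p k \<and>
     i \<in> set (pre_digraph.awalk_verts (undirected G) r p)}"

definition parent_of :: "('v, 'a) pre_digraph \<Rightarrow> 'v set \<Rightarrow> 'v \<Rightarrow> 'v \<Rightarrow> bool" where
  "parent_of G R j i \<longleftrightarrow> j \<noteq> i \<and> i \<in> descendants G R j \<and>
     (\<exists>a \<in> arcs G. {tail G a, head G a} = {i, j})"

definition node_sgn :: "('v, 'a) pre_digraph \<Rightarrow> 'v set \<Rightarrow> 'v \<Rightarrow> int" where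
  "node_sgn G R i =
     (if i \<in> R \<or> (\<exists>a \<in> in_arcs G i. parent_of G R (tail G a) i) then 1 else - 1)"

definition arrow_sgn :: "('v, 'a) pre_digraph \<Rightarrow> 'v set \<Rightarrow> 'a \<Rightarrow> int" where
  "arrow_sgn G R a = (if parent_of G R (tail G a) (head G a) then 1 else - 1)"


section \<open>The lattice, the seed and the dual basis\<close>

datatype 'v gen = P 'v nat | X 'v nat

type_synonym 'v lat = "'v gen \<Rightarrow>\<^sub>0 int"

definition gens :: "'v set \<Rightarrow> ('v \<Rightarrow> nat) \<Rightarrow> 'v gen set" where
  "gens V d = {P i m |i m. i \<in> V \<and> 1 \<le> m \<and> m \<le> d i} \<union> {X i m |i m. i \<in> V \<and> 1 \<le> m \<and> m \<le> d i}"

text \<open>The lattice of the quiver is \<open>lattice (verts G) d\<close>; the lattice of the single node \<open>i\<close> is its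
  sublattice \<open>lattice {i} d\<close>.\<close>

definition lattice :: "'v set \<Rightarrow> ('v \<Rightarrow> nat) \<Rightarrow> 'v lat set" where
  "lattice V d = carrier (free_Abelian_group (gens V d))"

abbreviation pp :: "'v \<Rightarrow> nat \<Rightarrow> 'v lat" where "pp i m \<equiv> frag_of (P i m)"
abbreviation xx :: "'v \<Rightarrow> nat \<Rightarrow> 'v lat" where "xx i m \<equiv> frag_of (X i m)"

fun gen_form :: "'v gen \<Rightarrow> 'v gen \<Rightarrow> int" where
  "gen_form (P i m) (X j n) = (if i = j \<and> m = n then 1 else 0)"
| "gen_form (X j n) (P i m) = (if i = j \<and> m = n then - 1 else 0)"
| "gen_form (P i m) (P j n) = 0"
| "gen_form (X i m) (X j n) = 0"

definition form :: "'v lat \<Rightarrow> 'v lat \<Rightarrow> int" where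
  "form \<kappa> \<mu> = (\<Sum>g \<in> Poly_Mapping.keys \<kappa>. \<Sum>h \<in> Poly_Mapping.keys \<mu>.
     Poly_Mapping.lookup \<kappa> g * Poly_Mapping.lookup \<mu> h * gen_form g h)"

definition p_fund :: "'v \<Rightarrow> nat \<Rightarrow> 'v lat" where
  "p_fund i m = (\<Sum>r = 1..m. pp i r)"

definition x_fund :: "'v \<Rightarrow> nat \<Rightarrow> 'v lat" where
  "x_fund i m = (\<Sum>r = 1..m. xx i r)"

definition e_s :: "'v \<Rightarrow> nat \<Rightarrow> 'v lat" where
  "e_s i m = xx i (m + 1) - xx i m"

definition e_t :: "'v \<Rightarrow> nat \<Rightarrow> 'v lat" where
  "e_t i m = pp i m - pp i (m + 1) + xx i m - xx i (m + 1)"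

definition e_arrow :: "('v, 'a) pre_digraph \<Rightarrow> ('v \<Rightarrow> nat) \<Rightarrow> 'a \<Rightarrow> 'v lat" where
  "e_arrow G d a = pp (head G a) (d (head G a)) - pp (tail G a) 1"

definition node_seed :: "('v \<Rightarrow> nat) \<Rightarrow> 'v \<Rightarrow> 'v lat set" where
  "node_seed d i = (\<Union>m \<in> {1..<d i}. {e_s i m, e_t i m})"

definition seed :: "('v, 'a) pre_digraph \<Rightarrow> ('v \<Rightarrow> nat) \<Rightarrow> 'v lat set" where
  "seed G d = (\<Union>i \<in> verts G. node_seed d i) \<union> e_arrow G d ` arcs G"

definition x_desc :: "('v, 'a) pre_digraph \<Rightarrow> ('v \<Rightarrow> nat) \<Rightarrow> 'v set \<Rightarrow> 'v \<Rightarrow> 'v lat" where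
  "x_desc G d R j = (\<Sum>k \<in> descendants G R j. x_fund k (d k))"

definition rho :: "('v, 'a) pre_digraph \<Rightarrow> ('v \<Rightarrow> nat) \<Rightarrow> 'v set \<Rightarrow> 'v \<Rightarrow> 'v lat" where
  "rho G d R i =
     (if node_sgn G R i = 1 then (\<Sum>a \<in> out_arcs G i. x_desc G d R (head G a))
      else - x_fund i (d i) - (\<Sum>a \<in> in_arcs G i. x_desc G d R (tail G a)))"

definition xi_t :: "('v, 'a) pre_digraph \<Rightarrow> ('v \<Rightarrow> nat) \<Rightarrow> 'v set \<Rightarrow> 'v \<Rightarrow> nat \<Rightarrow> 'v lat" where
  "xi_t G d R i m = x_fund i m + rho G d R i"

definition xi_s :: "('v, 'a) pre_digraph \<Rightarrow> ('v \<Rightarrow> nat) \<Rightarrow> 'v set \<Rightarrow> 'v \<Rightarrow> nat \<Rightarrow> 'v lat" where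
  "xi_s G d R i m = p_fund i m + x_fund i m - p_fund i (d i) + rho G d R i"

definition xi_node :: "('v \<Rightarrow> nat) \<Rightarrow> 'v \<Rightarrow> 'v lat" where
  "xi_node d i = - p_fund i (d i)"

definition xi_comp :: "('v \<Rightarrow> nat) \<Rightarrow> 'v set \<Rightarrow> 'v lat" where
  "xi_comp d C = (\<Sum>i \<in> C. x_fund i (d i))"

definition xi_arrow :: "('v, 'a) pre_digraph \<Rightarrow> ('v \<Rightarrow> nat) \<Rightarrow> 'v set \<Rightarrow> 'a \<Rightarrow> 'v lat" where
  "xi_arrow G d R a =
     (if arrow_sgn G R a = 1 then x_desc G d R (head G a) else - x_desc G d R (tail G a))"

definition dual_seed :: "('v, 'a) pre_digraph \<Rightarrow> ('v \<Rightarrow> nat) \<Rightarrow> 'v set \<Rightarrow> 'v lat set" where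
  "dual_seed G d R =
     (\<Union>i \<in> verts G. \<Union>m \<in> {1..<d i}. {xi_t G d R i m, xi_s G d R i m}) \<union>
     xi_node d ` verts G \<union>
     (\<lambda>i. xi_comp d (component_of G i)) ` verts G \<union>
     xi_arrow G d R ` arcs G"


section \<open>The quantum torus and the universally Laurent algebra\<close>

text \<open>The base ring of integral Laurent polynomials in \<open>q\<close>, as the group ring of the integers.\<close>

type_synonym qlaurent = "int \<Rightarrow>\<^sub>0 int"

definition qpow :: "int \<Rightarrow> qlaurent" where
  "qpow k = Poly_Mapping.single k 1"

definition minus_q_pow :: "int \<Rightarrow> qlaurent" where
  "minus_q_pow k = (if even k then qpow k else - qpow k)"

type_synonym 'v qtor = "'v lat \<Rightarrow>\<^sub>0 qlaurent"

definition Y :: "'v lat \<Rightarrow> 'v qtor" where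
  "Y \<kappa> = Poly_Mapping.single \<kappa> 1"

definition qt_mult :: "'v qtor \<Rightarrow> 'v qtor \<Rightarrow> 'v qtor" where
  "qt_mult A B = (\<Sum>\<kappa> \<in> Poly_Mapping.keys A. \<Sum>\<mu> \<in> Poly_Mapping.keys B.
     Poly_Mapping.single (\<kappa> + \<mu>) (minus_q_pow (- form \<kappa> \<mu>) * Poly_Mapping.lookup A \<kappa> * Poly_Mapping.lookup B \<mu>))"

definition qt_scale :: "qlaurent \<Rightarrow> 'v qtor \<Rightarrow> 'v qtor" where
  "qt_scale c A = Poly_Mapping.map ((*) c) A"

definition qtorus :: "'v qtor ring" where
  "qtorus = \<lparr>carrier = UNIV, monoid.mult = qt_mult, monoid.one = Y 0, ring.zero = 0, ring.add = (+)\<rparr>"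

text \<open>\<open>Psi_coeff k\<close> is the coefficient of \<open>X ^ k\<close> in the product of the geometric series
  \<open>1 / (1 - q ^ (2 n + 1) X)\<close>; the limit is \<open>q\<close>-adic.\<close>

definition Psi_coeff :: "nat \<Rightarrow> int fps" where
  "Psi_coeff k = lim (\<lambda>N. fps_nth (\<Prod>n<N. Abs_fps (\<lambda>j. (fps_X ^ (2 * n + 1)) ^ j)) k)"

definition qlaurent_to_fls :: "qlaurent \<Rightarrow> int fls" where
  "qlaurent_to_fls c = Abs_fls (Poly_Mapping.lookup c)"

text \<open>The coefficients at \<open>Y \<kappa>\<close> of \<open>\<Psi>(Y (- e)) A\<close> and \<open>A \<Psi>(Y (- e))\<close> in the completion of the
  quantum torus in the direction of \<open>- e\<close>. For \<open>e \<noteq> 0\<close> only finitely many terms \<open>Y (- e) ^ n = Y (- n e)\<close>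
  of the series contribute.\<close>

definition Psi_left :: "'v lat \<Rightarrow> 'v qtor \<Rightarrow> 'v lat \<Rightarrow> int fls" where
  "Psi_left e A \<kappa> = (\<Sum>n | Poly_Mapping.lookup (qt_mult (Y (frag_cmul (- int n) e)) A) \<kappa> \<noteq> 0.
     fps_to_fls (Psi_coeff n) * qlaurent_to_fls (Poly_Mapping.lookup (qt_mult (Y (frag_cmul (- int n) e)) A) \<kappa>))"

definition Psi_right :: "'v lat \<Rightarrow> 'v qtor \<Rightarrow> 'v lat \<Rightarrow> int fls" where
  "Psi_right e A \<kappa> = (\<Sum>n | Poly_Mapping.lookup (qt_mult A (Y (frag_cmul (- int n) e))) \<kappa> \<noteq> 0.
     fps_to_fls (Psi_coeff n) * qlaurent_to_fls (Poly_Mapping.lookup (qt_mult A (Y (frag_cmul (- int n) e))) \<kappa>))"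

definition torus_of :: "'v lat set \<Rightarrow> 'v qtor set" where
  "torus_of L = {A. Poly_Mapping.keys A \<subseteq> L}"

text \<open>\<open>B\<close> is the element \<open>\<Psi>(Y (- e)) A \<Psi>(Y (- e))\<^sup>-\<^sup>1\<close>, written without the inverse.\<close>

definition univ_laurent :: "'v lat set \<Rightarrow> 'v lat set \<Rightarrow> 'v qtor set" where
  "univ_laurent L S =
     {A \<in> torus_of L. \<forall>e \<in> S. \<exists>B \<in> torus_of L. Psi_left e A = Psi_right e B}"

definition node_laurent :: "('v \<Rightarrow> nat) \<Rightarrow> 'v \<Rightarrow> 'v qtor set" where
  "node_laurent d i = univ_laurent (lattice {i} d) (node_seed d i)"

definition quiver_laurent :: "('v, 'a) pre_digraph \<Rightarrow> ('v \<Rightarrow> nat) \<Rightarrow> 'v qtor set" where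
  "quiver_laurent G d = univ_laurent (lattice (verts G) d) (seed G d)"


section \<open>Difference operators\<close>


text \<open>Laurent polynomials in the \<open>w i r\<close> over the base ring: the exponent vector of a monomial is
  a finitely supported function on the indices \<open>(i, r)\<close>. The linear order on the nodes is used
  only to obtain the integral domain instance, hence the fraction field.\<close>

type_synonym 'v expo = "('v \<times> nat) \<Rightarrow>\<^sub>0 int"
type_synonym 'v wlaurent = "'v expo \<Rightarrow>\<^sub>0 qlaurent"
type_synonym 'v wfrac = "'v wlaurent fract"

text \<open>The base-ring-linear map sending the monomial of exponent \<open>\<nu>\<close> to \<open>q ^ c \<nu>\<close> times the
  monomial of exponent \<open>t \<nu>\<close>.\<close>

definition wsubst :: "('v expo \<Rightarrow> 'v expo) \<Rightarrow> ('v expo \<Rightarrow> int) \<Rightarrow> 'v wlaurent \<Rightarrow> 'v wlaurent" where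
  "wsubst t c a = (\<Sum>\<nu> \<in> Poly_Mapping.keys a. Poly_Mapping.single (t \<nu>) (qpow (c \<nu>) * Poly_Mapping.lookup a \<nu>))"

definition emb :: "'v::linorder wlaurent \<Rightarrow> 'v wfrac" where
  "emb a = Fraction_Field.Fract a 1"

text \<open>The extension of a ring homomorphism \<open>\<phi>\<close> to those fractions \<open>a / b\<close> with \<open>\<phi> b \<noteq> 0\<close>.\<close>

definition frac_map :: "('v::linorder wlaurent \<Rightarrow> 'v wlaurent) \<Rightarrow> 'v wfrac \<Rightarrow> 'v wfrac" where
  "frac_map \<phi> h = (THE y. \<exists>a b. b \<noteq> 0 \<and> \<phi> b \<noteq> 0 \<and> h = Fraction_Field.Fract a b \<and>
     y = Fraction_Field.Fract (\<phi> a) (\<phi> b))"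

definition base_const :: "qlaurent \<Rightarrow> 'v::linorder wfrac" where
  "base_const c = emb (Poly_Mapping.single 0 c)"

definition qq :: "'v::linorder wfrac" where
  "qq = base_const (qpow 1)"

definition w :: "'v \<Rightarrow> nat \<Rightarrow> 'v::linorder wfrac" where
  "w i r = emb (Poly_Mapping.single (frag_of (i, r)) 1)"

type_synonym 'v dop = "'v expo \<Rightarrow>\<^sub>0 'v wfrac"

definition expo_pairing :: "'v expo \<Rightarrow> 'v expo \<Rightarrow> int" where
  "expo_pairing \<mu> \<nu> = (\<Sum>k \<in> Poly_Mapping.keys \<mu>. Poly_Mapping.lookup \<mu> k * Poly_Mapping.lookup \<nu> k)"

text \<open>Conjugation by \<open>D \<mu>\<close>, that is \<open>w i r \<mapsto> q ^ (2 \<mu> (i, r)) w i r\<close>.\<close>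

definition shift :: "'v expo \<Rightarrow> 'v::linorder wfrac \<Rightarrow> 'v wfrac" where
  "shift \<mu> = frac_map (wsubst id (\<lambda>\<nu>. 2 * expo_pairing \<mu> \<nu>))"

definition d_mult :: "'v::linorder dop \<Rightarrow> 'v dop \<Rightarrow> 'v dop" where
  "d_mult A B = (\<Sum>\<mu> \<in> Poly_Mapping.keys A. \<Sum>\<nu> \<in> Poly_Mapping.keys B.
     Poly_Mapping.single (\<mu> + \<nu>) (Poly_Mapping.lookup A \<mu> * shift \<mu> (Poly_Mapping.lookup B \<nu>)))"

definition d_scale :: "'v::linorder wfrac \<Rightarrow> 'v dop \<Rightarrow> 'v dop" where
  "d_scale h A = Poly_Mapping.map ((*) h) A"

text \<open>Difference operators with arbitrary rational coefficients. All the algebras below, those of the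
  single nodes and their tensor product, are realized inside this ring.\<close>

definition dops :: "'v::linorder dop ring" where
  "dops = \<lparr>carrier = UNIV, monoid.mult = d_mult, monoid.one = Poly_Mapping.single 0 1,
     ring.zero = 0, ring.add = (+)\<rparr>"

definition node_ix :: "('v \<Rightarrow> nat) \<Rightarrow> 'v \<Rightarrow> ('v \<times> nat) set" where
  "node_ix d i = {i} \<times> {1..d i}"

definition wlaurents_in :: "('v \<times> nat) set \<Rightarrow> 'v wlaurent set" where
  "wlaurents_in I = {a. \<forall>\<nu> \<in> Poly_Mapping.keys a. Poly_Mapping.keys \<nu> \<subseteq> I}"

text \<open>\<open>1 - q ^ (2 k) w i r / w i s\<close>, an equation of the divisor below.\<close>

definition root_factor :: "'v \<Rightarrow> nat \<Rightarrow> nat \<Rightarrow> int \<Rightarrow> 'v wlaurent" where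
  "root_factor i r s k = 1 - Poly_Mapping.single (frag_of (i, r) - frag_of (i, s)) (qpow (2 * k))"

definition local_coeffs :: "('v \<Rightarrow> nat) \<Rightarrow> 'v \<Rightarrow> 'v::linorder wfrac set" where
  "local_coeffs d i = {Fraction_Field.Fract a (\<Prod>(r, s, k)\<leftarrow>ks. root_factor i r s k) |a ks.
     a \<in> wlaurents_in (node_ix d i) \<and> (\<forall>(r, s, k) \<in> set ks. 1 \<le> r \<and> r < s \<and> s \<le> d i)}"

definition D_loc :: "('v \<Rightarrow> nat) \<Rightarrow> 'v \<Rightarrow> 'v::linorder dop set" where
  "D_loc d i = {A. \<forall>\<mu> \<in> Poly_Mapping.keys A.
     Poly_Mapping.keys \<mu> \<subseteq> node_ix d i \<and> Poly_Mapping.lookup A \<mu> \<in> local_coeffs d i}"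

definition permute_expo :: "'v \<Rightarrow> (nat \<Rightarrow> nat) \<Rightarrow> 'v expo \<Rightarrow> 'v expo" where
  "permute_expo i \<pi> = frag_extend (\<lambda>(j, m). frag_of (j, if j = i then \<pi> m else m))"

definition permute_wlaurent :: "'v \<Rightarrow> (nat \<Rightarrow> nat) \<Rightarrow> 'v wlaurent \<Rightarrow> 'v wlaurent" where
  "permute_wlaurent i \<pi> = wsubst (permute_expo i \<pi>) (\<lambda>_. 0)"

definition d_symmetric :: "('v \<Rightarrow> nat) \<Rightarrow> 'v \<Rightarrow> 'v::linorder dop \<Rightarrow> bool" where
  "d_symmetric d i A \<longleftrightarrow> (\<forall>\<pi>. \<pi> permutes {1..d i} \<longrightarrow>
     (\<forall>\<mu>. Poly_Mapping.lookup A (permute_expo i \<pi> \<mu>) = frac_map (permute_wlaurent i \<pi>) (Poly_Mapping.lookup A \<mu>)))"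

text \<open>Restriction to the divisor \<open>q ^ (2 k) w i r = w i s\<close>, that is \<open>w i r \<mapsto> q ^ (- 2 k) w i s\<close>.\<close>

definition restrict_div :: "'v \<Rightarrow> nat \<Rightarrow> nat \<Rightarrow> int \<Rightarrow> 'v wlaurent \<Rightarrow> 'v wlaurent" where
  "restrict_div i r s k =
     wsubst (\<lambda>\<nu>. \<nu> + frag_cmul (Poly_Mapping.lookup \<nu> (i, r)) (frag_of (i, s) - frag_of (i, r)))
            (\<lambda>\<nu>. - 2 * k * Poly_Mapping.lookup \<nu> (i, r))"

definition simple_pole :: "'v \<Rightarrow> nat \<Rightarrow> nat \<Rightarrow> int \<Rightarrow> 'v::linorder wfrac \<Rightarrow> bool" where
  "simple_pole i r s k h \<longleftrightarrow>
     (\<exists>a b. emb (root_factor i r s k) * h = Fraction_Field.Fract a b \<and> restrict_div i r s k b \<noteq> 0)"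

definition residue_at :: "'v \<Rightarrow> nat \<Rightarrow> nat \<Rightarrow> int \<Rightarrow> 'v::linorder wfrac \<Rightarrow> 'v wfrac" where
  "residue_at i r s k h = frac_map (restrict_div i r s k) (emb (root_factor i r s k) * h)"

definition D_res :: "('v \<Rightarrow> nat) \<Rightarrow> 'v \<Rightarrow> 'v::linorder dop set" where
  "D_res d i = {A \<in> D_loc d i. d_symmetric d i A \<and>
     (\<forall>\<mu> r s k. 1 \<le> r \<and> r < s \<and> s \<le> d i \<longrightarrow>
        simple_pole i r s k (Poly_Mapping.lookup A \<mu>) \<and>
        residue_at i r s k (Poly_Mapping.lookup A \<mu>) +
        residue_at i r s k (Poly_Mapping.lookup A (permute_expo i (transpose r s) \<mu> +
          frag_cmul k (frag_of (i, r) - frag_of (i, s)))) = 0)}"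


section \<open>Dressed minuscule monopole operators and the Coulomb branch\<close>

text \<open>A dressing of a node of dimension \<open>D\<close> is an integral Laurent polynomial in the variables
  \<open>1, \<dots>, D\<close>, symmetric under permutations preserving the block \<open>1, \<dots>, n\<close>. (Laurent polynomials
  over the base ring would generate the same Coulomb branch, since the monopole operators are
  multilinear in the dressings.)\<close>

type_synonym dressing = "(nat \<Rightarrow>\<^sub>0 int) \<Rightarrow>\<^sub>0 int"

definition dressings :: "nat \<Rightarrow> nat \<Rightarrow> dressing set" where
  "dressings D n = {f. (\<forall>\<nu> \<in> Poly_Mapping.keys f. Poly_Mapping.keys \<nu> \<subseteq> {1..D}) \<and>
     (\<forall>\<pi>. \<pi> permutes {1..D} \<and> \<pi> ` {1..n} = {1..n} \<longrightarrow>
        (\<forall>\<nu>. Poly_Mapping.lookup f (frag_extend (\<lambda>m. frag_of (\<pi> m)) \<nu>) = Poly_Mapping.lookup f \<nu>))}"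

text \<open>Evaluation at the variables with index in \<open>J\<close> followed by the remaining ones; by symmetry the
  order inside the two blocks is irrelevant.\<close>

definition dressing_value :: "('v \<Rightarrow> nat) \<Rightarrow> 'v \<Rightarrow> nat set \<Rightarrow> dressing \<Rightarrow> 'v::linorder wfrac" where
  "dressing_value d l J f =
     (let js = sorted_list_of_set J @ sorted_list_of_set ({1..d l} - J)
      in emb (\<Sum>\<nu> \<in> Poly_Mapping.keys f.
           Poly_Mapping.single (frag_extend (\<lambda>m. frag_of (l, js ! (m - 1))) \<nu>)
             (Poly_Mapping.single 0 (Poly_Mapping.lookup f \<nu>))))"

definition minuscule_subsets :: "'v set \<Rightarrow> ('v \<Rightarrow> nat) \<Rightarrow> ('v \<Rightarrow> nat) \<Rightarrow> ('v \<Rightarrow> nat set) set" where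
  "minuscule_subsets V d n = (\<Pi>\<^sub>E l \<in> V. {J. J \<subseteq> {1..d l} \<and> card J = n l})"

definition E_op :: "('v::linorder, 'a) pre_digraph \<Rightarrow> ('v \<Rightarrow> nat) \<Rightarrow> ('v \<Rightarrow> nat) \<Rightarrow>
    ('v \<Rightarrow> dressing) \<Rightarrow> 'v dop" where
  "E_op G d n f = (\<Sum>J \<in> minuscule_subsets (verts G) d n.
     Poly_Mapping.single (\<Sum>l \<in> verts G. \<Sum>r \<in> J l. frag_of (l, r))
       ((\<Prod>a \<in> arcs G. \<Prod>r \<in> J (tail G a). \<Prod>s \<in> {1..d (head G a)} - J (head G a).
           1 - qq * w (tail G a) r * inverse (w (head G a) s)) *
        (\<Prod>l \<in> verts G. dressing_value d l (J l) (f l)) *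
        (\<Prod>l \<in> verts G. \<Prod>r \<in> J l. \<Prod>s \<in> {1..d l} - J l.
           1 / (1 - w l s * inverse (w l r)))))"

definition F_op :: "('v::linorder, 'a) pre_digraph \<Rightarrow> ('v \<Rightarrow> nat) \<Rightarrow> ('v \<Rightarrow> nat) \<Rightarrow>
    ('v \<Rightarrow> dressing) \<Rightarrow> 'v dop" where
  "F_op G d n f = (\<Sum>J \<in> minuscule_subsets (verts G) d n.
     Poly_Mapping.single (- (\<Sum>l \<in> verts G. \<Sum>r \<in> J l. frag_of (l, r)))
       ((\<Prod>a \<in> arcs G. \<Prod>r \<in> J (head G a). \<Prod>s \<in> {1..d (tail G a)} - J (tail G a).
           1 - qq * w (tail G a) s * inverse (w (head G a) r)) *
        (\<Prod>l \<in> verts G. dressing_value d l (J l) (f l)) *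
        (\<Prod>l \<in> verts G. \<Prod>r \<in> J l. \<Prod>s \<in> {1..d l} - J l.
           1 / (1 - w l r * inverse (w l s)))))"

definition monopole_data :: "('v, 'a) pre_digraph \<Rightarrow> ('v \<Rightarrow> nat) \<Rightarrow>
    (('v \<Rightarrow> nat) \<times> ('v \<Rightarrow> dressing)) set" where
  "monopole_data G d = {(n, f). \<forall>l \<in> verts G. n l \<le> d l \<and> f l \<in> dressings (d l) (n l)}"

definition symmetric_wlaurents :: "('v, 'a) pre_digraph \<Rightarrow> ('v \<Rightarrow> nat) \<Rightarrow> 'v wlaurent set" where
  "symmetric_wlaurents G d = {a \<in> wlaurents_in (\<Union>i \<in> verts G. node_ix d i).
     \<forall>i \<in> verts G. \<forall>\<pi>. \<pi> permutes {1..d i} \<longrightarrow> permute_wlaurent i \<pi> a = a}"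

definition coulomb_branch :: "('v::linorder, 'a) pre_digraph \<Rightarrow> ('v \<Rightarrow> nat) \<Rightarrow> 'v dop set" where
  "coulomb_branch G d = generate_ring dops
     ((\<lambda>a. Poly_Mapping.single 0 (emb a)) ` symmetric_wlaurents G d \<union>
      (\<lambda>(n, f). E_op G d n f) ` monopole_data G d \<union>
      (\<lambda>(n, f). F_op G d n f) ` monopole_data G d)"


section \<open>The isomorphisms\<close>

definition qalg_hom :: "'v::linorder qtor set \<Rightarrow> 'v dop set \<Rightarrow> ('v qtor \<Rightarrow> 'v dop) set" where
  "qalg_hom A B = {h \<in> ring_hom (qtorus\<lparr>carrier := A\<rparr>) (dops\<lparr>carrier := B\<rparr>).
     \<forall>c. \<forall>a \<in> A. h (qt_scale c a) = d_scale (base_const c) (h a)}"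

definition qalg_iso :: "'v::linorder qtor set \<Rightarrow> 'v dop set \<Rightarrow> ('v qtor \<Rightarrow> 'v dop) set" where
  "qalg_iso A B = qalg_hom A B \<inter> ring_iso (qtorus\<lparr>carrier := A\<rparr>) (dops\<lparr>carrier := B\<rparr>)"

text \<open>The product over \<open>m\<close> has pairwise commuting factors.\<close>

definition hamiltonian :: "('v \<Rightarrow> nat) \<Rightarrow> 'v \<Rightarrow> nat \<Rightarrow> 'v qtor" where
  "hamiltonian d i n = (\<Sum>I | I \<subseteq> {1..d i} \<and> card I = n.
     qt_mult (Y (\<Sum>r \<in> I. pp i r))
       (foldr (\<lambda>m. qt_mult (Y 0 - qt_scale (qpow 1) (Y (xx i (m + 1) - xx i m))))
          (sorted_list_of_set {m. 1 \<le> m \<and> m < d i \<and> m \<notin> I \<and> m + 1 \<in> I}) (Y 0)))"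

definition elem_sym :: "('v \<Rightarrow> nat) \<Rightarrow> 'v::linorder \<Rightarrow> nat \<Rightarrow> 'v dop" where
  "elem_sym d i n = Poly_Mapping.single 0 (\<Sum>J | J \<subseteq> {1..d i} \<and> card J = n. \<Prod>r \<in> J. w i r)"

definition node_monopole :: "('v \<Rightarrow> nat) \<Rightarrow> 'v::linorder \<Rightarrow> nat \<Rightarrow> (nat set \<Rightarrow> 'v wfrac) \<Rightarrow> 'v dop" where
  "node_monopole d i n g = (\<Sum>J | J \<subseteq> {1..d i} \<and> card J = n.
     Poly_Mapping.single (\<Sum>r \<in> J. frag_of (i, r))
       ((\<Prod>r \<in> J. \<Prod>s \<in> {1..d i} - J. 1 / (1 - w i s / w i r)) * g J))"

definition node_iso :: "('v \<Rightarrow> nat) \<Rightarrow> 'v::linorder \<Rightarrow> ('v qtor \<Rightarrow> 'v dop) \<Rightarrow> bool" where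
  "node_iso d i W \<longleftrightarrow> W \<in> qalg_iso (node_laurent d i) (D_res d i) \<and>
     (\<forall>n \<in> {1..d i}.
        W (hamiltonian d i n) = elem_sym d i n \<and>
        W (Y (x_fund i n)) =
          d_scale (qq powi (- int (n * (n - 1) div 2))) (node_monopole d i n (\<lambda>J. 1)) \<and>
        W (Y (p_fund i n + x_fund i n)) =
          d_scale ((- qq) ^ n * qq powi (- int (n * (n - 1) div 2)))
            (node_monopole d i n (\<lambda>J. \<Prod>j \<in> J. w i j)))"

text \<open>The tensor products over the nodes are the subalgebras generated by the (commuting) tensor
  factors inside the quantum torus and inside the difference operators, respectively; the tensor
  product of the \<open>W i\<close> is the algebra homomorphism restricting to \<open>W i\<close> on the \<open>i\<close>-th factor.\<close>

definition tensor_laurent :: "'v set \<Rightarrow> ('v \<Rightarrow> nat) \<Rightarrow> 'v qtor set" where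
  "tensor_laurent V d = generate_ring qtorus (\<Union>i \<in> V. node_laurent d i)"

definition tensor_D_res :: "'v set \<Rightarrow> ('v \<Rightarrow> nat) \<Rightarrow> 'v::linorder dop set" where
  "tensor_D_res V d = generate_ring dops (\<Union>i \<in> V. D_res d i)"

definition tensor_map :: "'v set \<Rightarrow> ('v \<Rightarrow> nat) \<Rightarrow> ('v::linorder \<Rightarrow> 'v qtor \<Rightarrow> 'v dop) \<Rightarrow>
    ('v qtor \<Rightarrow> 'v dop) \<Rightarrow> bool" where
  "tensor_map V d W WG \<longleftrightarrow> WG \<in> qalg_hom (tensor_laurent V d) (tensor_D_res V d) \<and>
     (\<forall>i \<in> V. \<forall>A \<in> node_laurent d i. WG A = W i A)"

end

theory Submission
  imports Defs
begin

text \<open>All vectors of the dual basis have one of two shapes. There are a node \<open>i\<close>, a number \<open>m \<le> d i\<close> and a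
set \<open>S\<close> of other nodes such that \<open>\<xi>\<close> is \<open>b + (\<Sum>l \<in> S. x_fund l (d l))\<close> or
\<open>b - x_fund i (d i) - (\<Sum>l \<in> S. x_fund l (d l))\<close>, where \<open>b\<close> is \<open>x_fund i m\<close>, possibly increased by
\<open>p_fund i m - p_fund i (d i)\<close>. The first shape yields an operator \<open>E\<close>, the second one an operator \<open>F\<close>.

The sublattices of different nodes are orthogonal, so \<open>Y \<xi>\<close> is a product of monomials at the single
nodes, and its image is the product of their images. A node \<open>l \<in> S\<close> contributes, up to a power of
\<open>q\<close>, the product of all \<open>D\<close>-variables of \<open>l\<close>, because \<open>{1..d l}\<close> is its only subset of full size
and the rational coefficient of this subset is an empty product. As images of invertible elements,
the images of \<open>Y (- x_fund l (d l))\<close> and \<open>Y (- p_fund i (d i))\<close> are determined by those of their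
inverses; the second inverse is the top Hamiltonian, which is mapped to the product of the \<open>w\<close>-variables.
At the node \<open>i\<close> there remains a sum over the subsets \<open>J\<close> of size \<open>m\<close>, with the coefficients of a
minuscule monopole operator and, if the \<open>p\<close>-part is present, the dressing by the inverses of all \<open>w i s\<close>
with \<open>s \<notin> J\<close>. Subtracting \<open>x_fund i (d i)\<close> turns the shift by \<open>J\<close> into the inverse shift by the
complement of \<open>J\<close>, and this is the summation index of \<open>F\<close>. The products above also create signs; they
are moved into the dressing, where integral coefficients are at one's disposal.

What remains to be compared are the factors attached to the arrows. For the operator with rank \<open>m\<close> at \<open>i\<close>
(or \<open>d i - m\<close> for \<open>F\<close>), full rank on \<open>S\<close> and rank \<open>0\<close> elsewhere they are empty products provided that
every arrow starting at a node of positive rank (for \<open>F\<close>: ending there) has full rank at its other end.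
This is where the forest enters. The sets \<open>S\<close> are made of subtrees, a subtree can only be
left through the arrow above its topmost node, and the signs in the definition of the dual basis make
this arrow point in the harmless direction. The same condition on the arrows makes the pairing of \<open>\<xi>\<close>
with every vector of the seed \<open>0\<close> or \<open>1\<close>, and then \<open>Y \<xi>\<close> is universally Laurent by the functional
equation of the quantum dilogarithm.\<close>

section \<open>The coefficients of the quantum dilogarithm\<close>

definition Psi_partial :: "nat \<Rightarrow> int fps fps" where
  "Psi_partial N = (\<Prod>n<N. Abs_fps (\<lambda>j. (fps_X ^ (2 * n + 1)) ^ j))"

lemma geometric_fps_mult:
  fixes c :: "'a::comm_ring_1" shows "(1 - fps_const c * fps_X) * Abs_fps (\<lambda>j. c ^ j) = 1"
proof (rule fps_ext)
  fix n show "fps_nth ((1 - fps_const c * fps_X) * Abs_fps (\<lambda>j. c ^ j)) n = fps_nth 1 n"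
    by (cases n) (simp_all add: algebra_simps mult.assoc)
qed

text \<open>Multiplying by the next geometric series is undone by multiplying with
  \<open>1 - q ^ (2 N + 1) X\<close>; comparing coefficients gives a recursion in both indices.\<close>

lemma Psi_partial_Suc:
  "fps_nth (Psi_partial (Suc N)) 0 = fps_nth (Psi_partial N) 0"
  "fps_nth (Psi_partial (Suc N)) (Suc k) =
     fps_nth (Psi_partial N) (Suc k) + fps_X ^ (2 * N + 1) * fps_nth (Psi_partial (Suc N)) k"
proof -
  let ?Q = "fps_X ^ (2 * N + 1) :: int fps"
  have "(1 - fps_const ?Q * fps_X) * Psi_partial (Suc N) =
      Psi_partial N * ((1 - fps_const ?Q * fps_X) * Abs_fps (\<lambda>j. ?Q ^ j))"
    by (simp add: Psi_partial_def mult_ac)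
  then have eq: "Psi_partial (Suc N) - fps_const ?Q * (fps_X * Psi_partial (Suc N)) = Psi_partial N"
    by (simp only: geometric_fps_mult mult_1_right) (simp add: algebra_simps)
  show "fps_nth (Psi_partial (Suc N)) 0 = fps_nth (Psi_partial N) 0"
    unfolding eq[symmetric] by simp
  have "fps_nth (Psi_partial (Suc N)) (Suc k) - ?Q * fps_nth (Psi_partial (Suc N)) k
      = fps_nth (Psi_partial N) (Suc k)"
    unfolding eq[symmetric] by simp
  then show "fps_nth (Psi_partial (Suc N)) (Suc k) =
     fps_nth (Psi_partial N) (Suc k) + fps_X ^ (2 * N + 1) * fps_nth (Psi_partial (Suc N)) k"
    by (simp add: algebra_simps)
qed

lemma Psi_partial_0: "fps_nth (Psi_partial N) 0 = 1"
  by (induction N) (simp_all add: Psi_partial_Suc, simp add: Psi_partial_def)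

text \<open>The coefficientwise form of the relation between the values of the finite product at \<open>q\<^sup>2 X\<close> and
  at \<open>X\<close>. The last term comes from the factor that the truncation leaves over; it is divisible by a
  power of \<open>q\<close> that grows with \<open>N\<close>, hence disappears in the limit.\<close>

lemma Psi_partial_rec:
  "(1 - fps_X ^ (2 * Suc k)) * fps_nth (Psi_partial N) (Suc k) =
     (fps_X - fps_X ^ (2 * N + 2 * k + 1)) * fps_nth (Psi_partial N) k"
proof (induction N arbitrary: k)
  case 0
  show ?case by (cases k) (simp_all add: Psi_partial_def)
next
  case (Suc N)
  define x :: "int fps" where "x = fps_X"
  define Q where "Q = x ^ (2 * N + 1)"
  note IHN = Suc.IH
  show ?case
  proof (induction k)
    case 0
    have "(1 - x ^ 2) * fps_nth (Psi_partial N) (Suc 0) = x - Q"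
      using IHN[of 0] by (simp add: Psi_partial_0 x_def Q_def power2_eq_square)
    then have "(1 - x ^ 2) * (fps_nth (Psi_partial N) (Suc 0) + Q) = x - x ^ 2 * Q"
      by (simp only: distrib_left left_diff_distrib) simp
    then show ?case
      by (simp add: Psi_partial_Suc Psi_partial_0 x_def Q_def power_add mult_ac power2_eq_square)
  next
    case (Suc k)
    let ?a = "fps_nth (Psi_partial N)" and ?b = "fps_nth (Psi_partial (Suc N))"
    define y where "y = x ^ (2 * Suc k)"
    have b2: "?b (Suc (Suc k)) = ?a (Suc (Suc k)) + Q * ?b (Suc k)"
      and b1: "?b (Suc k) = ?a (Suc k) + Q * ?b k"
      by (simp_all add: Psi_partial_Suc Q_def x_def)
    have i1: "(1 - x ^ 2 * y) * ?a (Suc (Suc k)) = (x - Q * y) * ?a (Suc k)"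
      using IHN[of "Suc k"] by (simp add: x_def Q_def y_def power_add mult_ac power2_eq_square)
    have i2: "(1 - y) * ?b (Suc k) = (x - Q * y) * ?b k"
      using Suc.IH by (simp add: x_def Q_def y_def power_add mult_ac power2_eq_square)
    have "(1 - x ^ 2 * y) * ?b (Suc (Suc k)) = (x - x ^ 2 * Q * y) * ?b (Suc k)"
    proof -
      have "(1 - x ^ 2 * y) * ?b (Suc (Suc k)) = (x - Q * y) * ?a (Suc k) + (1 - x ^ 2 * y) * Q * ?b (Suc k)"
        by (simp only: b2 distrib_left i1 mult.assoc)
      also have "?a (Suc k) = ?b (Suc k) - Q * ?b k"
        using b1 by simp
      also have "(x - Q * y) * (?b (Suc k) - Q * ?b k) = (x - Q * y) * ?b (Suc k) - Q * ((x - Q * y) * ?b k)"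
        by (simp add: right_diff_distrib mult.left_commute)
      also have "(x - Q * y) * ?b k = (1 - y) * ?b (Suc k)"
        by (rule i2[symmetric])
      finally show ?thesis
        by (simp add: algebra_simps)
    qed
    then show ?case by (simp add: x_def Q_def y_def power_add mult_ac power2_eq_square)
  qed
qed

lemma Psi_partial_stable:
  "n < N \<Longrightarrow> fps_nth (fps_nth (Psi_partial (N + M)) k) n = fps_nth (fps_nth (Psi_partial N) k) n"
proof (induction M)
  case (Suc M)
  then show ?case
    by (cases k) (simp_all only: Psi_partial_Suc add_Suc_right fps_add_nth fps_X_power_mult_nth, simp_all)
qed simp

text \<open>The \<open>q\<close>-adic limit exists because the coefficients of low \<open>q\<close>-degree are eventually constant, and
  it can be read off from any sufficiently long partial product.\<close>

lemma Psi_coeff_nth: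
  assumes "n < N" shows "fps_nth (Psi_coeff k) n = fps_nth (fps_nth (Psi_partial N) k) n"
proof -
  define L where "L = Abs_fps (\<lambda>n. fps_nth (fps_nth (Psi_partial (Suc n)) k) n)"
  have nth: "fps_nth (fps_nth (Psi_partial N) k) n = fps_nth L n" if nN: "n < N" for n N
  proof -
    obtain M where "N = Suc n + M" using less_imp_Suc_add[OF nN] by auto
    then show ?thesis using Psi_partial_stable[of n "Suc n" M k] by (simp add: L_def)
  qed
  have "(\<lambda>N. fps_nth (Psi_partial N) k) \<longlonglongrightarrow> L"
  proof (rule tendsto_fpsI)
    fix n
    show "eventually (\<lambda>N. fps_nth (fps_nth (Psi_partial N) k) n = fps_nth L n) sequentially"
      by (rule eventually_sequentiallyI[of "Suc n"]) (simp add: nth)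
  qed
  then have "Psi_coeff k = L"
    unfolding Psi_coeff_def Psi_partial_def by (rule limI)
  then show ?thesis using nth assms by simp
qed

text \<open>This is the functional equation \<open>\<Psi>(q\<^sup>2 X) = (1 - q X) \<Psi>(X)\<close>, coefficient by coefficient.\<close>

lemma Psi_coeff_rec: "(1 - fps_X ^ (2 * Suc k)) * Psi_coeff (Suc k) = fps_X * Psi_coeff k"
proof (rule fps_ext)
  fix n
  have "fps_nth ((1 - fps_X ^ (2 * Suc k)) * Psi_coeff (Suc k)) n =
      fps_nth ((1 - fps_X ^ (2 * Suc k)) * fps_nth (Psi_partial (Suc n)) (Suc k)) n"
    by (simp add: left_diff_distrib fps_X_power_mult_nth Psi_coeff_nth[where N = "Suc n"] del: power_Suc)
  also have "\<dots> = fps_nth (fps_X * fps_nth (Psi_partial (Suc n)) k) n"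
    unfolding Psi_partial_rec by (simp add: left_diff_distrib fps_X_power_mult_nth del: power_Suc)
  also have "\<dots> = fps_nth (fps_X * Psi_coeff k) n"
    by (cases n) (simp_all add: Psi_coeff_nth[where N = "Suc n"])
  finally show "fps_nth ((1 - fps_X ^ (2 * Suc k)) * Psi_coeff (Suc k)) n = fps_nth (fps_X * Psi_coeff k) n" .
qed

section \<open>The skew form on the lattice and products in the quantum torus\<close>

text \<open>The form is a sum over supports, which do not behave additively; enlarging the index sets to a
  common finite set makes the summation range independent of the arguments.\<close>

lemma form_superset:
  assumes "finite A" "Poly_Mapping.keys \<kappa> \<subseteq> A" "finite B" "Poly_Mapping.keys \<mu> \<subseteq> B"
  shows "form \<kappa> \<mu> = (\<Sum>g \<in> A. \<Sum>h \<in> B. Poly_Mapping.lookup \<kappa> g * Poly_Mapping.lookup \<mu> h * gen_form g h)"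
proof -
  have "form \<kappa> \<mu> = (\<Sum>g \<in> A. \<Sum>h \<in> Poly_Mapping.keys \<mu>. Poly_Mapping.lookup \<kappa> g * Poly_Mapping.lookup \<mu> h * gen_form g h)"
    unfolding form_def using assms by (intro sum.mono_neutral_left) (auto simp: in_keys_iff)
  also have "\<dots> = (\<Sum>g \<in> A. \<Sum>h \<in> B. Poly_Mapping.lookup \<kappa> g * Poly_Mapping.lookup \<mu> h * gen_form g h)"
    using assms by (intro sum.cong refl sum.mono_neutral_left) (auto simp: in_keys_iff)
  finally show ?thesis .
qed

lemma form_add_left: "form (\<kappa> + \<kappa>') \<mu> = form \<kappa> \<mu> + form \<kappa>' \<mu>"
proof -
  let ?A = "Poly_Mapping.keys \<kappa> \<union> Poly_Mapping.keys \<kappa>' \<union> Poly_Mapping.keys (\<kappa> + \<kappa>')"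
  show ?thesis
    by (subst (1 2 3) form_superset[of ?A _ "Poly_Mapping.keys \<mu>"])
       (auto simp: lookup_add algebra_simps sum.distrib)
qed

lemma gen_form_skew: "gen_form g h = - gen_form h g"
  by (cases g; cases h) auto

lemma form_skew: "form \<kappa> \<mu> = - form \<mu> \<kappa>"
proof -
  have "form \<mu> \<kappa> = (\<Sum>h \<in> Poly_Mapping.keys \<kappa>. \<Sum>g \<in> Poly_Mapping.keys \<mu>.
      Poly_Mapping.lookup \<mu> g * Poly_Mapping.lookup \<kappa> h * gen_form g h)"
    unfolding form_def by (rule sum.swap)
  also have "\<dots> = (\<Sum>h \<in> Poly_Mapping.keys \<kappa>. \<Sum>g \<in> Poly_Mapping.keys \<mu>.
      - (Poly_Mapping.lookup \<kappa> h * Poly_Mapping.lookup \<mu> g * gen_form h g))"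
    by (intro sum.cong refl) (subst gen_form_skew, simp)
  also have "\<dots> = - form \<kappa> \<mu>"
    unfolding form_def by (simp add: sum_negf)
  finally show ?thesis by simp
qed

lemma form_self: "form \<kappa> \<kappa> = 0"
  using form_skew[of \<kappa> \<kappa>] by simp

lemma form_add_right: "form \<mu> (\<kappa> + \<kappa>') = form \<mu> \<kappa> + form \<mu> \<kappa>'"
  by (subst (1 2 3) form_skew) (simp add: form_add_left)

lemma form_zero [simp]: "form 0 \<mu> = 0" "form \<mu> 0 = 0"
  by (simp_all add: form_def)

lemma form_minus_left: "form (- \<kappa>) \<mu> = - form \<kappa> \<mu>"
  using form_add_left[of \<kappa> "- \<kappa>" \<mu>] by simp

lemma form_minus_right: "form \<mu> (- \<kappa>) = - form \<mu> \<kappa>"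
  using form_add_right[of \<mu> \<kappa> "- \<kappa>"] by simp

lemma form_diff_left: "form (\<kappa> - \<kappa>') \<mu> = form \<kappa> \<mu> - form \<kappa>' \<mu>"
  using form_add_left[of \<kappa> "- \<kappa>'" \<mu>] by (simp add: form_minus_left)

lemma form_cmul_left: "form (frag_cmul c \<kappa>) \<mu> = c * form \<kappa> \<mu>"
proof (cases "c = 0")
  case False
  then have "Poly_Mapping.keys (frag_cmul c \<kappa>) = Poly_Mapping.keys \<kappa>" by auto
  then show ?thesis by (simp add: form_def sum_distrib_left mult.assoc)
qed simp

lemma form_cmul_right: "form \<mu> (frag_cmul c \<kappa>) = c * form \<mu> \<kappa>"
  by (subst (1 2) form_skew) (simp add: form_cmul_left)

lemma form_pp_left: "form (pp i m) \<mu> = Poly_Mapping.lookup \<mu> (X i m)"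
proof -
  have "form (pp i m) \<mu> = (\<Sum>h \<in> insert (X i m) (Poly_Mapping.keys \<mu>). Poly_Mapping.lookup \<mu> h * gen_form (P i m) h)"
    by (subst form_superset[of "{P i m}" _ "insert (X i m) (Poly_Mapping.keys \<mu>)"]) auto
  also have "\<dots> = (\<Sum>h \<in> insert (X i m) (Poly_Mapping.keys \<mu>). if h = X i m then Poly_Mapping.lookup \<mu> h else 0)"
    by (intro sum.cong refl, case_tac x) auto
  finally show ?thesis by simp
qed

lemma form_xx_left: "form (xx i m) \<mu> = - Poly_Mapping.lookup \<mu> (P i m)"
proof -
  have "form (xx i m) \<mu> = (\<Sum>h \<in> insert (P i m) (Poly_Mapping.keys \<mu>). Poly_Mapping.lookup \<mu> h * gen_form (X i m) h)"
    by (subst form_superset[of "{X i m}" _ "insert (P i m) (Poly_Mapping.keys \<mu>)"]) auto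
  also have "\<dots> = (\<Sum>h \<in> insert (P i m) (Poly_Mapping.keys \<mu>). if h = P i m then - Poly_Mapping.lookup \<mu> h else 0)"
    by (intro sum.cong refl, case_tac x) auto
  finally show ?thesis by simp
qed

lemma form_e_s: "form (e_s i m) \<mu> = Poly_Mapping.lookup \<mu> (P i m) - Poly_Mapping.lookup \<mu> (P i (m + 1))"
  by (simp add: e_s_def form_diff_left form_xx_left)

lemma form_e_t: "form (e_t i m) \<mu> = Poly_Mapping.lookup \<mu> (X i m) - Poly_Mapping.lookup \<mu> (X i (m + 1))
    - (Poly_Mapping.lookup \<mu> (P i m) - Poly_Mapping.lookup \<mu> (P i (m + 1)))"
  by (simp add: e_t_def form_diff_left form_add_left form_pp_left form_xx_left)

lemma form_e_arrow: "form (e_arrow G d a) \<mu> =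
    Poly_Mapping.lookup \<mu> (X (head G a) (d (head G a))) - Poly_Mapping.lookup \<mu> (X (tail G a) 1)"
  by (simp add: e_arrow_def form_diff_left form_pp_left)

lemma lookup_p_fund: "Poly_Mapping.lookup (p_fund i m) (P j r) = (if i = j \<and> 1 \<le> r \<and> r \<le> m then 1 else 0)"
  "Poly_Mapping.lookup (p_fund i m) (X j r) = 0"
  unfolding p_fund_def lookup_sum by (auto simp: lookup_single when_def intro!: sum.neutral)

lemma lookup_x_fund: "Poly_Mapping.lookup (x_fund i m) (X j r) = (if i = j \<and> 1 \<le> r \<and> r \<le> m then 1 else 0)"
  "Poly_Mapping.lookup (x_fund i m) (P j r) = 0"
  unfolding x_fund_def lookup_sum by (auto simp: lookup_single when_def intro!: sum.neutral)

lemma fund_0 [simp]: "p_fund i 0 = 0" "x_fund i 0 = 0"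
  by (simp_all add: p_fund_def x_fund_def)

lemma mem_lattice_iff: "\<kappa> \<in> lattice V d \<longleftrightarrow> Poly_Mapping.keys \<kappa> \<subseteq> gens V d"
  by (simp add: lattice_def)

lemma lattice_closed:
  "0 \<in> lattice V d"
  "\<kappa> \<in> lattice V d \<Longrightarrow> \<mu> \<in> lattice V d \<Longrightarrow> \<kappa> + \<mu> \<in> lattice V d"
  "\<kappa> \<in> lattice V d \<Longrightarrow> \<mu> \<in> lattice V d \<Longrightarrow> \<kappa> - \<mu> \<in> lattice V d"
  "\<kappa> \<in> lattice V d \<Longrightarrow> - \<kappa> \<in> lattice V d"
  using keys_add[of \<kappa> \<mu>] keys_diff[of \<kappa> \<mu>] by (auto simp: mem_lattice_iff)

lemma lattice_sum: "(\<And>l. l \<in> A \<Longrightarrow> f l \<in> lattice V d) \<Longrightarrow> (\<Sum>l \<in> A. f l) \<in> lattice V d"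
  by (induction A rule: infinite_finite_induct) (auto intro: lattice_closed)

lemma lattice_mono: "V \<subseteq> V' \<Longrightarrow> \<kappa> \<in> lattice V d \<Longrightarrow> \<kappa> \<in> lattice V' d"
  unfolding mem_lattice_iff gens_def by blast

lemma generators_in_lattice:
  "i \<in> V \<Longrightarrow> 1 \<le> m \<Longrightarrow> m \<le> d i \<Longrightarrow> pp i m \<in> lattice V d"
  "i \<in> V \<Longrightarrow> 1 \<le> m \<Longrightarrow> m \<le> d i \<Longrightarrow> xx i m \<in> lattice V d"
  by (auto simp: mem_lattice_iff gens_def)

lemma fund_in_lattice:
  "i \<in> V \<Longrightarrow> m \<le> d i \<Longrightarrow> p_fund i m \<in> lattice V d"
  "i \<in> V \<Longrightarrow> m \<le> d i \<Longrightarrow> x_fund i m \<in> lattice V d"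
  unfolding p_fund_def x_fund_def by (auto intro!: lattice_sum generators_in_lattice)

lemma node_seed_in_lattice: "i \<in> V \<Longrightarrow> node_seed d i \<subseteq> lattice V d"
  by (auto simp: node_seed_def e_s_def e_t_def intro!: lattice_closed generators_in_lattice)

text \<open>Elements of the quantum torus supported at different nodes commute, which is what makes the
  factors of the tensor product commute.\<close>

lemma form_disjoint_nodes:
  assumes "\<kappa> \<in> lattice V d" "\<mu> \<in> lattice V' d" "V \<inter> V' = {}"
  shows "form \<kappa> \<mu> = 0"
proof -
  have "gen_form g h = 0" if "g \<in> gens V d" "h \<in> gens V' d" for g h
    using that assms(3) by (cases g; cases h) (auto simp: gens_def)
  then show ?thesis
    using assms unfolding form_def mem_lattice_iff by (intro sum.neutral ballI) (auto simp: subset_iff)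
qed

lemma qpow_add: "qpow (a + b) = qpow a * qpow b"
  by (simp add: qpow_def mult_single)

lemma qpow_0 [simp]: "qpow 0 = 1"
  by (simp add: qpow_def)

lemma minus_q_pow_add: "minus_q_pow (a + b) = minus_q_pow a * minus_q_pow b"
  by (auto simp: minus_q_pow_def qpow_add)

lemma minus_q_pow_0 [simp]: "minus_q_pow 0 = 1"
  by (simp add: minus_q_pow_def)

lemma minus_q_pow_nonzero [simp]: "minus_q_pow a \<noteq> 0"
  using minus_q_pow_add[of a "- a"] by auto

lemma qt_mult_single:
  "qt_mult (Poly_Mapping.single \<kappa> a) (Poly_Mapping.single \<mu> b) =
     Poly_Mapping.single (\<kappa> + \<mu>) (minus_q_pow (- form \<kappa> \<mu>) * a * b)"
  by (cases "a = 0"; cases "b = 0") (simp_all add: qt_mult_def)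

lemma qt_mult_Y: "qt_mult (Y \<kappa>) (Y \<mu>) = Poly_Mapping.single (\<kappa> + \<mu>) (minus_q_pow (- form \<kappa> \<mu>))"
  by (simp add: Y_def qt_mult_single)

lemma qt_mult_Y_orthogonal: "form \<kappa> \<mu> = 0 \<Longrightarrow> qt_mult (Y \<kappa>) (Y \<mu>) = Y (\<kappa> + \<mu>)"
  unfolding qt_mult_Y by (simp add: Y_def)

section \<open>Universally Laurent monomials\<close>

lemma minus_q_pow_single: "minus_q_pow k = Poly_Mapping.single k (if even k then 1 else - 1)"
  by (simp add: minus_q_pow_def qpow_def single_uminus)

lemma qlaurent_to_fls_single:
  "qlaurent_to_fls (Poly_Mapping.single k c) = fls_const c * fls_X_intpow k"
proof (rule fls_eqI)
  fix n
  have "\<forall>\<^sub>\<infinity>n::nat. Poly_Mapping.lookup (Poly_Mapping.single k c) (- int n) = 0"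
    unfolding MOST_nat by (intro exI[of _ "nat \<bar>k\<bar>"]) (auto simp: lookup_single when_def)
  then show "fls_nth (qlaurent_to_fls (Poly_Mapping.single k c)) n = fls_nth (fls_const c * fls_X_intpow k) n"
    unfolding qlaurent_to_fls_def by (simp add: lookup_single when_def)
qed

lemma qlaurent_to_fls_minus_q_pow_add:
  "qlaurent_to_fls (minus_q_pow (a + b)) = qlaurent_to_fls (minus_q_pow a) * qlaurent_to_fls (minus_q_pow b)"
proof -
  have "qlaurent_to_fls (Poly_Mapping.single (a + b) (c * c')) =
      qlaurent_to_fls (Poly_Mapping.single a c) * qlaurent_to_fls (Poly_Mapping.single b c')" for c c'
    unfolding qlaurent_to_fls_single fls_X_intpow_times_fls_X_intpow[symmetric] fls_const_mult_const[symmetric]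
    by (simp only: mult_ac)
  from this[of "if even a then 1 else - 1" "if even b then 1 else - 1"] show ?thesis
    unfolding minus_q_pow_single by (auto split: if_splits)
qed

lemma qlaurent_to_fls_zero [simp]: "qlaurent_to_fls 0 = 0"
  using qlaurent_to_fls_single[of 0 0] by simp

text \<open>The functional equation in the normalization needed for conjugation: the left hand side is what
  \<open>\<Psi>\<close> times a monomial of pairing \<open>1\<close> produces, the right hand side is the monomial and its translate
  by \<open>- e\<close>, times \<open>\<Psi>\<close>. The signs of \<open>(- q) ^ k\<close> turn the minus sign of the functional equation into a plus.\<close>

lemma Psi_coeff_shift:
  defines "T \<equiv> \<lambda>k. qlaurent_to_fls (minus_q_pow k)"
  shows "fps_to_fls (Psi_coeff (Suc k)) * T (int (Suc k)) =
    fps_to_fls (Psi_coeff (Suc k)) * T (- int (Suc k)) + fps_to_fls (Psi_coeff k) * T (- int k)"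
proof -
  let ?c = "\<lambda>k. fps_to_fls (Psi_coeff k)" and ?n = "int (Suc k)"
  have add: "T (a + b) = T a * T b" for a b
    by (simp add: T_def qlaurent_to_fls_minus_q_pow_add)
  have "fps_to_fls ((1 - fps_X ^ (2 * Suc k)) * Psi_coeff (Suc k)) = fps_to_fls (fps_X * Psi_coeff k)"
    by (simp only: Psi_coeff_rec)
  then have "(1 - fls_X ^ (2 * Suc k)) * ?c (Suc k) = fls_X * ?c k"
    by (simp only: fls_times_fps_to_fls fps_to_fls_minus fps_one_to_fls fps_to_fls_power fps_X_to_fls)
  moreover have "fls_X ^ (2 * Suc k) = T (2 * ?n)"
    by (simp only: T_def minus_q_pow_single qlaurent_to_fls_single fls_X_power_conv_shift_1) simp
  moreover have "fls_X = - T 1"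
    by (simp add: T_def minus_q_pow_single qlaurent_to_fls_single fls_X_conv_shift_1)
  ultimately have "(1 - T (2 * ?n)) * ?c (Suc k) * T (- ?n) = - T 1 * ?c k * T (- ?n)"
    by simp
  then have "?c (Suc k) * T (- ?n) - ?c (Suc k) * (T (2 * ?n) * T (- ?n)) = - ?c k * (T 1 * T (- ?n))"
    by (simp add: algebra_simps)
  then show ?thesis
    unfolding add[symmetric] by (simp add: algebra_simps)
qed

lemma qt_mult_Y_plus:
  assumes "e \<noteq> 0"
  shows "qt_mult (Y \<xi> + Y (\<xi> - e)) (Y \<mu>) = qt_mult (Y \<xi>) (Y \<mu>) + qt_mult (Y (\<xi> - e)) (Y \<mu>)"
proof -
  have "Poly_Mapping.keys (Y \<xi> + Y (\<xi> - e)) = {\<xi>, \<xi> - e}"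
    using assms by (auto simp: in_keys_iff Y_def lookup_add lookup_single when_def split: if_splits)
  then show ?thesis
    using assms by (simp add: qt_mult_def Y_def lookup_add lookup_single when_def)
qed

text \<open>A monomial of pairing \<open>0\<close> commutes with \<open>Y (- e)\<close>, hence is not changed by the conjugation.\<close>

lemma Psi_conjugation_neutral:
  assumes "form e \<xi> = 0"
  shows "Psi_left e (Y \<xi>) = Psi_right e (Y \<xi>)"
proof -
  have "qt_mult (Y (frag_cmul (- int n) e)) (Y \<xi>) = qt_mult (Y \<xi>) (Y (frag_cmul (- int n) e))" for n
    unfolding qt_mult_Y using assms form_skew[of \<xi> e] by (simp add: form_cmul_left form_cmul_right add.commute)
  then show ?thesis unfolding Psi_left_def Psi_right_def by simp
qed

text \<open>For pairing \<open>1\<close>, moving \<open>Y \<xi>\<close> past \<open>\<Psi>\<close> replaces \<open>\<Psi>(X)\<close> by \<open>\<Psi>(q\<^sup>2 X) = (1 - q X) \<Psi>(X)\<close>, so the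
  conjugate of \<open>Y \<xi>\<close> is a sum of two monomials.\<close>

lemma Psi_conjugation_wall:
  assumes "form e \<xi> = 1"
  shows "Psi_left e (Y \<xi>) = Psi_right e (Y \<xi> + Y (\<xi> - e))"
proof
  fix \<kappa>
  let ?c = "\<lambda>k. fps_to_fls (Psi_coeff k)" and ?T = "\<lambda>k. qlaurent_to_fls (minus_q_pow k)"
  have e: "e \<noteq> 0" using assms by auto
  have inj: "\<xi> - frag_cmul a e = \<xi> - frag_cmul b e \<longleftrightarrow> a = b" for a b
    using e frag_cmul_diff_distrib[of a b e] by (metis diff_left_imp_eq eq_iff_diff_eq_0 frag_cmul_eq_0_iff)
  have "form \<xi> e = - 1" using assms form_skew[of \<xi> e] by simp
  then have left: "qt_mult (Y (frag_cmul (- int n) e)) (Y \<xi>) = Poly_Mapping.single (\<xi> - frag_cmul (int n) e) (minus_q_pow (int n))"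
    and right: "qt_mult (Y \<xi> + Y (\<xi> - e)) (Y (frag_cmul (- int n) e)) =
      Poly_Mapping.single (\<xi> - frag_cmul (int n) e) (minus_q_pow (- int n)) +
      Poly_Mapping.single (\<xi> - frag_cmul (int n + 1) e) (minus_q_pow (- int n))" for n
    unfolding qt_mult_Y_plus[OF e] qt_mult_Y using assms
    by (simp_all add: form_cmul_left form_cmul_right form_diff_left form_minus_left form_minus_right form_self frag_cmul_distrib algebra_simps flip: minus_frag_cmul)
  show "Psi_left e (Y \<xi>) \<kappa> = Psi_right e (Y \<xi> + Y (\<xi> - e)) \<kappa>"
  proof (cases "\<exists>N::nat. \<kappa> = \<xi> - frag_cmul (int N) e")
    case False
    then have "\<xi> - frag_cmul (int n) e \<noteq> \<kappa>" "\<xi> - frag_cmul (int n + 1) e \<noteq> \<kappa>" for n :: nat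
      by (metis, metis of_nat_Suc add.commute)
    then show ?thesis
      unfolding Psi_left_def Psi_right_def left right by (auto simp: lookup_add lookup_single when_def)
  next
    case True
    then obtain N :: nat where \<kappa>: "\<kappa> = \<xi> - frag_cmul (int N) e" by blast
    have L: "Poly_Mapping.lookup (qt_mult (Y (frag_cmul (- int n) e)) (Y \<xi>)) \<kappa> = (if n = N then minus_q_pow (int N) else 0)" for n
      unfolding left \<kappa> by (simp add: lookup_single when_def inj)
    have R: "Poly_Mapping.lookup (qt_mult (Y \<xi> + Y (\<xi> - e)) (Y (frag_cmul (- int n) e))) \<kappa> =
        (if n = N then minus_q_pow (- int N) else if Suc n = N then minus_q_pow (- int n) else 0)" for n
      unfolding right \<kappa> lookup_add lookup_single when_def inj by auto
    show ?thesis
    proof (cases N)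
      case 0
      then show ?thesis unfolding Psi_left_def Psi_right_def L R by simp
    next
      case (Suc M)
      have "{n. (if n = N then minus_q_pow (- int N) else if Suc n = N then minus_q_pow (- int n) else 0) \<noteq> 0} = {M, N}"
        using Suc by auto
      then show ?thesis
        unfolding Psi_left_def Psi_right_def L R using Psi_coeff_shift[of M] Suc by simp
    qed
  qed
qed

text \<open>For larger pairings the conjugate would be a longer product of binomials; the vectors of a dual basis
  only have pairings \<open>0\<close> and \<open>1\<close> with the seed.\<close>

lemma Y_in_univ_laurent:
  assumes "\<xi> \<in> lattice V d" "S \<subseteq> lattice V d" "\<And>e. e \<in> S \<Longrightarrow> form e \<xi> = 0 \<or> form e \<xi> = 1"
  shows "Y \<xi> \<in> univ_laurent (lattice V d) S"
proof -
  have "\<exists>B \<in> torus_of (lattice V d). Psi_left e (Y \<xi>) = Psi_right e B" if "e \<in> S" for e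
    using assms(3)[OF that]
  proof
    assume "form e \<xi> = 0"
    then show ?thesis using Psi_conjugation_neutral assms(1) by (intro bexI[of _ "Y \<xi>"]) (auto simp: torus_of_def Y_def)
  next
    assume "form e \<xi> = 1"
    moreover have "Poly_Mapping.keys (Y \<xi> + Y (\<xi> - e)) \<subseteq> {\<xi>, \<xi> - e}"
      using keys_add[of "Y \<xi>" "Y (\<xi> - e)"] by (auto simp: Y_def)
    moreover have "\<xi> - e \<in> lattice V d" using assms that by (blast intro: lattice_closed)
    ultimately show ?thesis
      using Psi_conjugation_wall assms(1) by (intro bexI[of _ "Y \<xi> + Y (\<xi> - e)"]) (auto simp: torus_of_def)
  qed
  then show ?thesis using assms(1) by (auto simp: univ_laurent_def torus_of_def Y_def)
qed

section \<open>Root paths in a forest\<close>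

definition rev_arc :: "'a \<times> bool \<Rightarrow> 'a \<times> bool" where
  "rev_arc e = (fst e, \<not> snd e)"

lemma undirected_simps [simp]:
  "verts (undirected G) = verts G"
  "arcs (undirected G) = arcs G \<times> UNIV"
  "tail (undirected G) (a, True) = tail G a"
  "head (undirected G) (a, True) = head G a"
  "tail (undirected G) (a, False) = head G a"
  "head (undirected G) (a, False) = tail G a"
  "tail (undirected G) (rev_arc e) = head (undirected G) e"
  "head (undirected G) (rev_arc e) = tail (undirected G) e"
  "rev_arc e \<in> arcs G \<times> UNIV \<longleftrightarrow> e \<in> arcs G \<times> UNIV"
  by (cases e; auto simp: undirected_def rev_arc_def)+

lemma rev_arc_rev_arc [simp]: "rev_arc (rev_arc e) = e"
  by (simp add: rev_arc_def)

text \<open>Walks that never turn back on the arrow just used.\<close>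

definition reduced :: "('a \<times> bool) list \<Rightarrow> bool" where
  "reduced p \<longleftrightarrow> successively (\<lambda>e f. f \<noteq> rev_arc e) p"

locale forest_quiver =
  fixes G :: "('v, 'a) pre_digraph" and R :: "'v set"
  assumes fin: "fin_digraph G"
    and forest: "undirected_forest G"
    and roots: "root_choice G R"
begin

abbreviation "U \<equiv> undirected G"

sublocale G: fin_digraph G by (rule fin)

sublocale U: fin_digraph U
proof
  show "finite (verts U)" "finite (arcs U)" by simp_all
  fix e assume "e \<in> arcs U"
  then show "tail U e \<in> verts U" "head U e \<in> verts U"
    by (cases e; cases "snd e"; auto)+
qed

lemma awalk_reverse: "U.awalk u p v \<Longrightarrow> U.awalk v (rev (map rev_arc p)) u"
proof (induction p arbitrary: u)
  case (Cons e p)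
  then have e: "e \<in> arcs U" "tail U e = u" and p: "U.awalk (head U e) p v"
    by (auto simp: U.awalk_Cons_iff)
  have "U.awalk (head U e) [rev_arc e] u"
    using e U.tail_in_verts[OF e(1)] by (simp add: U.awalk_Cons_iff U.awalk_Nil_iff)
  with Cons.IH[OF p] show ?case by (simp add: U.awalk_appendI)
qed (simp add: U.awalk_Nil_iff)

lemma reduced_infix: "reduced (q @ r @ s) \<Longrightarrow> reduced r"
  by (simp add: reduced_def successively_append_iff)

lemma reduced_reverse: "reduced p \<Longrightarrow> reduced (rev (map rev_arc p))"
proof -
  assume "reduced p"
  then have "successively (\<lambda>e f. rev_arc e \<noteq> f) p"
    unfolding reduced_def by (rule successively_mono) (metis rev_arc_rev_arc)
  then show ?thesis
    unfolding reduced_def by (simp add: successively_map successively_rev)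
qed

lemma apath_reduced: "U.apath u p v \<Longrightarrow> reduced p"
proof (induction p arbitrary: u)
  case (Cons e p)
  then have "reduced p" by (auto simp: U.apath_Cons_iff)
  moreover have "f \<noteq> rev_arc e" if "p = f # p'" for f p'
    using Cons.prems that by (cases p') (auto simp: U.apath_def U.awalk_Cons_iff)
  ultimately show ?case by (cases p) (auto simp: reduced_def)
qed (simp add: reduced_def)

text \<open>In a forest every nonempty closed walk must turn back somewhere. A shortest closed walk that does not
  turn back repeats no vertex, since the part between two visits would be shorter; and if it used an
  arrow in both directions, the second use would have to follow the first one immediately. So it
  would be an undirected cycle in the sense of \<open>undirected_forest\<close>.\<close>

lemma closed_reduced_empty: "U.awalk u p u \<Longrightarrow> reduced p \<Longrightarrow> p = []"
proof (induction "length p" arbitrary: u p rule: less_induct)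
  case less
  show ?case
  proof (rule ccontr)
    assume ne: "p \<noteq> []"
    then obtain e es where p: "p = e # es" by (cases p) auto
    have es: "U.awalk (head U e) es u" and e: "tail U e = u"
      using less.prems(1) by (auto simp: p U.awalk_Cons_iff)
    have dist: "distinct (U.awalk_verts (head U e) es)"
    proof (rule ccontr)
      assume "\<not> ?thesis"
      then obtain q r s x where *: "es = q @ r @ s" "0 < length r" "U.awalk x r x"
        using U.awalk_not_distinct_decomp[OF es] by blast
      then have "r = []"
        using less.hyps[of r x] less.prems(2) reduced_infix[of "e # q" r s] by (simp add: p)
      then show False using * by simp
    qed
    \<comment> \<open>each vertex of \<open>p\<close> is entered exactly once and left exactly once\<close>
    have heads: "distinct (map (head U) p)"
      using dist U.awalk_verts_conv'[of "head U e" es u] es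
      by (cases es) (auto simp: p U.awalk_Cons_iff U.cas_simp)
    have tails: "distinct (map (tail U) p)"
      using dist U.awalk_verts_conv[of "head U e" es] es e U.awlast_of_awalk[OF es]
      by (cases "es = []") (auto simp: p)
    have "distinct (map fst p)"
    proof (rule ccontr)
      assume "\<not> ?thesis"
      then obtain i j where ij: "i < j" "j < length p" "fst (p ! i) = fst (p ! j)"
        by (auto simp: distinct_conv_nth) (metis nat_neq_iff)
      have "p ! i \<noteq> p ! j"
        using ij heads nth_eq_iff_index_eq[of "map (head U) p" i j] by auto
      \<comment> \<open>the arrow \<open>p ! j\<close> leaves the vertex entered by \<open>p ! i\<close>, as does the arrow following \<open>p ! i\<close>\<close>
      then have pj: "p ! j = rev_arc (p ! i)"
        using ij by (auto simp: rev_arc_def prod_eq_iff)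
      have split: "take i p @ p ! i # p ! Suc i # drop (Suc (Suc i)) p = p"
        using ij by (simp add: Cons_nth_drop_Suc)
      have "U.cas u (take i p @ p ! i # p ! Suc i # drop (Suc (Suc i)) p) u"
        unfolding split using less.prems(1) by auto
      then have "map (tail U) p ! Suc i = map (tail U) p ! j"
        using pj ij by simp
      then have "j = Suc i"
        using tails ij nth_eq_iff_index_eq[of "map (tail U) p" "Suc i" j] by simp
      then show False
        using less.prems(2) pj ij unfolding reduced_def successively_conv_nth by auto
    qed
    moreover have "U.cycle p"
      unfolding U.cycle_def using less.prems(1) dist ne p by (intro exI[of _ u]) auto
    ultimately show False
      using forest unfolding undirected_forest_def by blast
  qed
qed

text \<open>If two paths with the same ends start with different arrows, then the reverse of the one followed by
  the other is a closed walk that does not turn back.\<close>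

lemma apath_unique: "U.apath u p v \<Longrightarrow> U.apath u q v \<Longrightarrow> p = q"
proof (induction p arbitrary: u q)
  case Nil
  then show ?case by (metis U.apath_Nil_iff U.apath_nonempty_ends)
next
  case (Cons e p)
  have "u \<noteq> v" using Cons.prems(1) U.apath_nonempty_ends by blast
  then obtain f q' where q: "q = f # q'"
    using Cons.prems(2) by (cases q) (auto simp: U.apath_Nil_iff)
  show ?case
  proof (cases "e = f")
    case True
    then show ?thesis using Cons.IH[of "head U e" q'] Cons.prems by (auto simp: q U.apath_Cons_iff)
  next
    case False
    let ?r = "rev (map rev_arc (e # p)) @ q"
    have "U.awalk v ?r v"
      using awalk_reverse[of u "e # p" v] Cons.prems unfolding U.apath_def by (blast intro: U.awalk_appendI)
    moreover have "reduced ?r"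
      using reduced_reverse[OF apath_reduced[OF Cons.prems(1)]] apath_reduced[OF Cons.prems(2)] False
      by (auto simp: reduced_def successively_append_iff q rev_arc_def)
    ultimately show ?thesis using closed_reduced_empty by blast
  qed
qed

text \<open>The list of arrows on the path from the root of the component down to \<open>k\<close>. All relations between
  nodes of the rooted forest are expressed through these lists.\<close>

definition root_path :: "'v \<Rightarrow> ('a \<times> bool) list" where
  "root_path k = (THE p. \<exists>r \<in> R. U.apath r p k)"

lemma component_of_awalk: "j \<in> component_of G i \<longleftrightarrow> (\<exists>p. U.awalk i p j)"
  by (simp add: component_of_def)

lemma root_path_eqI:
  assumes "r \<in> R" "U.apath r p k"
  shows "root_path k = p"
proof -
  have "q = p" if "s \<in> R" "U.apath s q k" for s q
  proof -
    have walks: "U.awalk r p k" "U.awalk s q k" using assms that by (auto simp: U.apath_def)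
    then have k: "k \<in> verts G" using U.awalk_last_in_verts by fastforce
    have "r \<in> component_of G k" "s \<in> component_of G k"
      using walks awalk_reverse by (auto simp: component_of_awalk)
    then have "s = r" using roots k assms(1) that(1) unfolding root_choice_def by blast
    then show ?thesis using assms(2) that(2) apath_unique by blast
  qed
  then show ?thesis unfolding root_path_def using assms by (intro the_equality) blast+
qed

lemma root_path_exists:
  assumes "k \<in> verts G"
  obtains r where "r \<in> R" "U.apath r (root_path k) k"
proof -
  obtain r where r: "r \<in> R" "r \<in> component_of G k"
    using roots assms unfolding root_choice_def by blast
  then obtain p where "U.awalk k p r" by (auto simp: component_of_awalk)
  then have "U.apath r (U.awalk_to_apath (rev (map rev_arc p))) k"
    using awalk_reverse U.apath_awalk_to_apath by blast
  then show ?thesis using that r root_path_eqI by metis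
qed

text \<open>Equality of the lists alone would not suffice on the right hand side: the roots of all components have
  the same empty root path. The walk from \<open>j\<close> to \<open>k\<close> keeps both nodes in one component.\<close>

lemma descendants_iff:
  "k \<in> descendants G R j \<longleftrightarrow> (\<exists>q. U.awalk j q k \<and> root_path k = root_path j @ q)"
proof
  assume "k \<in> descendants G R j"
  then obtain r p where rp: "r \<in> R" "U.apath r p k" "j \<in> set (U.awalk_verts r p)"
    by (auto simp: descendants_def)
  obtain q s where qs: "p = q @ s" "U.awalk r q j" "U.awalk j s k"
    using U.awalk_decomp[of r p k j] rp by (auto simp: U.apath_def)
  then have "U.apath r q j"
    using rp(2) U.apath_append_iff[of r q s k] U.awlast_of_awalk by fastforce
  then have "root_path j = q" "root_path k = p"
    using rp root_path_eqI by blast+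
  then show "\<exists>q. U.awalk j q k \<and> root_path k = root_path j @ q"
    using qs by blast
next
  assume "\<exists>q. U.awalk j q k \<and> root_path k = root_path j @ q"
  then obtain q where q: "U.awalk j q k" "root_path k = root_path j @ q" by blast
  then have "k \<in> verts G" using U.awalk_last_in_verts by fastforce
  then obtain r where r: "r \<in> R" "U.apath r (root_path k) k" by (rule root_path_exists)
  \<comment> \<open>the walk along \<open>root_path j\<close> from the root of \<open>k\<close> ends at \<open>j\<close>, because \<open>q\<close> connects its end with \<open>k\<close>\<close>
  let ?x = "U.awlast r (root_path j)"
  have "U.awalk ?x q k" "?x \<in> set (U.awalk_verts r (root_path k))"
    using r(2) by (auto simp: q(2) U.apath_append_iff U.apath_def U.awalk_verts_append)
  moreover from this have "?x = j"
    using U.awalk_ends[of j q k ?x k] q(1) by auto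
  ultimately show "k \<in> descendants G R j"
    using r unfolding descendants_def by auto
qed

lemma descendants_subset: "descendants G R j \<subseteq> verts G"
proof
  fix k assume "k \<in> descendants G R j"
  then obtain q where "U.awalk j q k" by (auto simp: descendants_iff)
  then show "k \<in> verts G" using U.awalk_last_in_verts[of j q k] by simp
qed

lemma self_descendant: "j \<in> verts G \<Longrightarrow> j \<in> descendants G R j"
  by (auto simp: descendants_iff U.awalk_Nil_iff)

lemma tail_neq_head: "e \<in> arcs U \<Longrightarrow> tail U e \<noteq> head U e"
  using closed_reduced_empty[of "tail U e" "[e]"] U.tail_in_verts[of e] U.head_in_verts[of e]
  by (auto simp: U.awalk_Cons_iff U.awalk_Nil_iff reduced_def)

text \<open>If the path to the tail of \<open>e\<close> avoids the head, then \<open>e\<close> extends it to the path to the head. Otherwise the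
  part of this path behind the head is a path joining the two ends of \<open>e\<close>, hence is the reversed arrow.\<close>

lemma root_path_arc:
  assumes "e \<in> arcs U"
  shows "root_path (head U e) = root_path (tail U e) @ [e] \<or>
    root_path (tail U e) = root_path (head U e) @ [rev_arc e]"
proof -
  let ?u = "tail U e" and ?v = "head U e"
  have uv: "?u \<in> verts G" "?v \<in> verts G" "?u \<noteq> ?v"
    using assms U.tail_in_verts U.head_in_verts tail_neq_head by auto
  have edge: "U.apath ?u [e] ?v" "U.apath ?v [rev_arc e] ?u"
    using assms uv by (auto simp: U.apath_Cons_iff U.apath_Nil_iff)
  obtain r where r: "r \<in> R" "U.apath r (root_path ?u) ?u"
    using uv(1) by (rule root_path_exists)
  show ?thesis
  proof (cases "?v \<in> set (U.awalk_verts r (root_path ?u))")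
    case False
    then have "U.apath r (root_path ?u @ [e]) ?v"
      using r(2) edge(1) uv(3) unfolding U.apath_append_iff
      by (auto simp: U.apath_def)
    then show ?thesis using r(1) root_path_eqI by blast
  next
    case True
    then obtain q s where qs: "root_path ?u = q @ s" "U.awalk r q ?v" "U.awalk ?v s ?u"
      using U.awalk_decomp[of r "root_path ?u" ?u ?v] r(2) by (auto simp: U.apath_def)
    then have "U.apath r q ?v" "U.apath ?v s ?u"
      using r(2) U.apath_append_iff[of r q s ?u] U.awlast_of_awalk by fastforce+
    then have "root_path ?v = q" "s = [rev_arc e]"
      using r(1) root_path_eqI edge(2) apath_unique by blast+
    then show ?thesis using qs(1) by simp
  qed
qed

text \<open>A traversed arrow leads from a parent to its child.\<close>

definition downward :: "'a \<times> bool \<Rightarrow> bool" where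
  "downward e \<longleftrightarrow> e \<in> arcs U \<and> root_path (head U e) = root_path (tail U e) @ [e]"

lemma downward_or_reverse: "e \<in> arcs U \<Longrightarrow> downward e \<or> downward (rev_arc e)"
  using root_path_arc[of e] by (auto simp: downward_def)

lemma downward_head_inj: "downward e \<Longrightarrow> downward f \<Longrightarrow> head U e = head U f \<Longrightarrow> e = f"
  by (auto simp: downward_def)

lemma downward_imp_descendant: "downward e \<Longrightarrow> head U e \<in> descendants G R (tail U e)"
  unfolding downward_def descendants_iff
  by (intro exI[of _ "[e]"]) (auto simp: U.awalk_Cons_iff U.awalk_Nil_iff U.head_in_verts simp del: undirected_simps(1))

lemma descendant_length: "k \<in> descendants G R j \<Longrightarrow> length (root_path j) \<le> length (root_path k)"
  by (auto simp: descendants_iff)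

lemma parent_of_iff: "parent_of G R j i \<longleftrightarrow> (\<exists>e. downward e \<and> tail U e = j \<and> head U e = i)"
proof
  assume *: "parent_of G R j i"
  then obtain a where a: "a \<in> arcs G" "{tail G a, head G a} = {i, j}" by (auto simp: parent_of_def)
  define e where "e = (a, tail G a = j)"
  have e: "e \<in> arcs U" "tail U e = j" "head U e = i"
    using a by (auto simp: e_def doubleton_eq_iff undirected_def)
  have "\<not> downward (rev_arc e)"
  proof
    assume "downward (rev_arc e)"
    then have "length (root_path j) = length (root_path i) + 1"
      using e(2,3) by (simp add: downward_def)
    moreover have "length (root_path j) \<le> length (root_path i)"
      using * descendant_length by (simp add: parent_of_def)
    ultimately show False by simp
  qed
  then show "\<exists>e. downward e \<and> tail U e = j \<and> head U e = i"
    using downward_or_reverse e by blast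
next
  assume "\<exists>e. downward e \<and> tail U e = j \<and> head U e = i"
  then obtain e where e: "downward e" "tail U e = j" "head U e = i" by blast
  then have "e \<in> arcs U" by (simp add: downward_def)
  moreover have "{tail G (fst e), head G (fst e)} = {i, j}"
    using e(2,3) by (cases e; cases "snd e") auto
  ultimately show "parent_of G R j i"
    using tail_neq_head[of e] downward_imp_descendant[OF e(1)] e(2,3)
    unfolding parent_of_def by (cases e) auto
qed

text \<open>A subtree can only be left through the arrow that leads to its topmost node.\<close>

lemma subtree_arc_closed:
  assumes "downward e" "f \<in> arcs U" "tail U f \<in> descendants G R (head U e)" "f \<noteq> rev_arc e"
  shows "head U f \<in> descendants G R (head U e)"
proof -
  obtain q where q: "U.awalk (head U e) q (tail U f)" "root_path (tail U f) = root_path (head U e) @ q"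
    using assms(3) by (auto simp: descendants_iff)
  from root_path_arc[OF assms(2)] show ?thesis
  proof
    assume "root_path (head U f) = root_path (tail U f) @ [f]"
    moreover have "U.awalk (head U e) (q @ [f]) (head U f)"
      using q(1) assms(2) by (intro U.awalk_appendI) (auto simp: U.awalk_Cons_iff U.awalk_Nil_iff U.head_in_verts simp del: undirected_simps(1,2))
    ultimately show ?thesis unfolding descendants_iff using q(2) by auto
  next
    assume *: "root_path (tail U f) = root_path (head U f) @ [rev_arc f]"
    show ?thesis
    proof (cases q rule: rev_cases)
      case Nil
      then have "rev_arc f = e" using * q(2) assms(1) by (simp add: downward_def)
      then show ?thesis using assms(4) by auto
    next
      case (snoc q' g)
      then have "g = rev_arc f" "root_path (head U f) = root_path (head U e) @ q'"
        using * q(2) by auto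
      moreover have "U.awalk (head U e) q' (head U f)"
        using q(1) snoc \<open>g = rev_arc f\<close> by (auto simp: U.awalk_Cons_iff)
      ultimately show ?thesis unfolding descendants_iff by auto
    qed
  qed
qed

text \<open>A common node would have both arrows at the same position of its root path.\<close>

lemma disjoint_subtrees:
  assumes "downward e" "downward f" "tail U e = tail U f" "e \<noteq> f"
  shows "descendants G R (head U e) \<inter> descendants G R (head U f) = {}"
proof -
  have "e = f" if k: "k \<in> descendants G R (head U e)" "k \<in> descendants G R (head U f)" for k
  proof -
    obtain q q' where "root_path k = root_path (head U e) @ q" "root_path k = root_path (head U f) @ q'"
      using k unfolding descendants_iff by blast
    moreover have "root_path (head U e) = root_path (tail U f) @ [e]"
      using assms(1,3) by (simp add: downward_def)
    moreover have "root_path (head U f) = root_path (tail U f) @ [f]"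
      using assms(2) by (simp add: downward_def)
    ultimately have "(root_path (tail U f) @ [e]) @ q = (root_path (tail U f) @ [f]) @ q'"
      by metis
    then show ?thesis by simp
  qed
  with assms(4) show ?thesis by blast
qed

lemma tail_not_in_subtree: "downward e \<Longrightarrow> tail U e \<notin> descendants G R (head U e)"
proof
  assume "downward e" "tail U e \<in> descendants G R (head U e)"
  then have "length (root_path (tail U e) @ [e]) \<le> length (root_path (tail U e))"
    using descendant_length unfolding downward_def by metis
  then show False by simp
qed

lemma component_arc_closed:
  assumes "a \<in> arcs G"
  shows "tail G a \<in> component_of G i \<longleftrightarrow> head G a \<in> component_of G i"
proof -
  have "U.awalk (tail G a) [(a, True)] (head G a)" "U.awalk (head G a) [(a, False)] (tail G a)"
    using assms by (auto simp: U.awalk_Cons_iff U.awalk_Nil_iff)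
  then show ?thesis
    unfolding component_of_awalk by (blast intro: U.awalk_appendI)
qed

lemma component_subset: "component_of G i \<subseteq> verts G"
proof
  fix j assume "j \<in> component_of G i"
  then obtain p where "U.awalk i p j" by (auto simp: component_of_awalk)
  then show "j \<in> verts G" using U.awalk_last_in_verts[of i p j] by simp
qed

lemma self_in_component: "i \<in> verts G \<Longrightarrow> i \<in> component_of G i"
  by (auto simp: component_of_awalk U.awalk_Nil_iff intro!: exI[of _ "[]"])

lemma finite_subset_verts: "S \<subseteq> verts G \<Longrightarrow> finite S"
  by (rule finite_subset) auto

end

section \<open>Multiplication of difference operators by special factors\<close>

lemma sum_of_monomials:
  fixes f :: "'a \<Rightarrow>\<^sub>0 'b::comm_monoid_add"
  shows "(\<Sum>\<nu> \<in> Poly_Mapping.keys f. Poly_Mapping.single \<nu> (Poly_Mapping.lookup f \<nu>)) = f"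
  by (rule poly_mapping_eqI) (auto simp: lookup_sum lookup_single when_def in_keys_iff)

lemma lookup_scalar_mult:
  fixes f :: "'a::comm_monoid_add \<Rightarrow>\<^sub>0 'b::comm_semiring_0"
  shows "Poly_Mapping.lookup (Poly_Mapping.single 0 a * f) \<nu> = a * Poly_Mapping.lookup f \<nu>"
proof -
  have "Poly_Mapping.single 0 a * f = (\<Sum>\<nu> \<in> Poly_Mapping.keys f. Poly_Mapping.single \<nu> (a * Poly_Mapping.lookup f \<nu>))"
    by (subst (1) sum_of_monomials[of f, symmetric]) (simp add: sum_distrib_left mult_single)
  then show ?thesis
    by (auto simp: lookup_sum lookup_single when_def in_keys_iff)
qed

lemma single_eq_0_iff [simp]: "Poly_Mapping.single k a = 0 \<longleftrightarrow> a = 0"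
  by (metis lookup_single_eq lookup_zero single_zero)

lemma emb_mult: "emb (a * b) = emb a * emb b"
  by (simp add: emb_def)
lemma emb_1 [simp]: "emb 1 = 1" and emb_0 [simp]: "emb 0 = 0"
  by (simp_all add: emb_def fract_collapse)
lemma emb_minus: "emb (- a) = - emb a"
  by (simp add: emb_def)
lemma emb_eq_0 [simp]: "emb a = 0 \<longleftrightarrow> a = 0"
  by (simp add: emb_def Zero_fract_def eq_fract)

lemma base_const_mult: "base_const (a * b) = base_const a * base_const b"
  by (simp add: base_const_def mult_single flip: emb_mult)
lemma base_const_1 [simp]: "base_const 1 = 1"
  by (simp add: base_const_def)
lemma base_const_minus: "base_const (- a) = - base_const a"
  by (simp add: base_const_def single_uminus emb_minus)

lemma base_const_qpow: "base_const (qpow k) = (qq :: 'v::linorder wfrac) powi k"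
proof -
  have qq: "(qq :: 'v wfrac) \<noteq> 0" by (simp add: qq_def base_const_def qpow_def)
  have nat: "base_const (qpow (int n)) = (qq :: 'v wfrac) ^ n" for n
    by (induction n) (simp_all add: qpow_add base_const_mult qq_def)
  show ?thesis
  proof (cases "k \<ge> 0")
    case True
    then show ?thesis using nat[of "nat k"] by (simp add: power_int_def)
  next
    case False
    then have "base_const (qpow k) * (qq :: 'v wfrac) ^ nat (- k) = 1"
      using qpow_add[of k "- k"] by (simp flip: nat base_const_mult)
    then show ?thesis using False qq by (simp add: power_int_def field_simps)
  qed
qed

text \<open>Linearity over the base ring: whatever fraction represents a constant, its numerator is this
  constant times its denominator, so \<open>shift\<close> fixes the constant.\<close>

lemma wsubst_base_const:
  "wsubst id c (Poly_Mapping.single 0 a * b) = Poly_Mapping.single 0 a * wsubst id c b"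
proof -
  have "wsubst id c (Poly_Mapping.single 0 a * b) =
      (\<Sum>\<nu> \<in> Poly_Mapping.keys b. Poly_Mapping.single \<nu> (qpow (c \<nu>) * (a * Poly_Mapping.lookup b \<nu>)))"
    unfolding wsubst_def by (rule sum.mono_neutral_cong_left) (auto simp: lookup_scalar_mult in_keys_iff)
  also have "\<dots> = Poly_Mapping.single 0 a * wsubst id c b"
    unfolding wsubst_def by (simp add: sum_distrib_left mult_single mult_ac)
  finally show ?thesis .
qed

lemma shift_base_const [simp]: "shift \<mu> (base_const a) = base_const a"
proof -
  define \<phi> where "\<phi> = wsubst id (\<lambda>\<nu>. 2 * expo_pairing \<mu> \<nu>)"
  have one: "\<phi> 1 = 1" by (simp add: \<phi>_def wsubst_def expo_pairing_def)
  have "\<phi> (Poly_Mapping.single 0 a) = Poly_Mapping.single 0 a"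
    using wsubst_base_const[of "\<lambda>\<nu>. 2 * expo_pairing \<mu> \<nu>" a 1] one by (simp add: \<phi>_def)
  moreover have "y = base_const a" if "b \<noteq> 0" "\<phi> b \<noteq> 0" "base_const a = Fraction_Field.Fract x b"
    "y = Fraction_Field.Fract (\<phi> x) (\<phi> b)" for x b y
  proof -
    have "x = Poly_Mapping.single 0 a * b"
      using that(1,3) by (simp add: base_const_def emb_def eq_fract)
    then have "\<phi> x = Poly_Mapping.single 0 a * \<phi> b"
      unfolding \<phi>_def by (simp add: wsubst_base_const)
    then show ?thesis using that(2,4) by (simp add: base_const_def emb_def eq_fract)
  qed
  ultimately show ?thesis
    unfolding shift_def frac_map_def \<phi>_def[symmetric]
    by (intro the_equality exI[of _ "Poly_Mapping.single 0 a"] exI[of _ 1] conjI) (auto simp: one base_const_def emb_def)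
qed

lemma shift_0 [simp]: "shift 0 h = h"
proof -
  have id: "wsubst id (\<lambda>\<nu>. 2 * expo_pairing 0 \<nu>) a = a" for a :: "'v wlaurent"
    unfolding wsubst_def expo_pairing_def by (simp add: sum_of_monomials)
  obtain a b where "h = Fraction_Field.Fract a b" "b \<noteq> 0"
    by (cases h) auto
  then show ?thesis
    unfolding shift_def frac_map_def id by (intro the_equality) auto
qed

lemma lookup_d_scale [simp]: "Poly_Mapping.lookup (d_scale c A) \<kappa> = c * Poly_Mapping.lookup A \<kappa>"
  by (simp add: d_scale_def Poly_Mapping.map.rep_eq when_def)

text \<open>Constants are fixed by all shifts, so they can be moved freely to the right factor. Together with
  \<open>lookup_d_mult_function\<close> this covers all products of difference operators below: the only factors
  depending on \<open>w\<close> that are met carry no shift and are multiplied from the left.\<close>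

lemma lookup_d_mult_const:
  fixes A :: "'v::linorder dop"
  shows "Poly_Mapping.lookup (d_mult A (Poly_Mapping.single \<nu> (base_const c))) \<kappa> =
     Poly_Mapping.lookup A (\<kappa> - \<nu>) * base_const c"
proof (cases "(base_const c :: 'v wfrac) = 0")
  case True
  show ?thesis unfolding True by (simp add: d_mult_def)
next
  case False
  have "Poly_Mapping.lookup (d_mult A (Poly_Mapping.single \<nu> (base_const c))) \<kappa> =
      (\<Sum>\<mu> \<in> Poly_Mapping.keys A. if \<mu> = \<kappa> - \<nu> then Poly_Mapping.lookup A \<mu> * base_const c else 0)"
    using False by (simp add: d_mult_def lookup_sum lookup_single when_def eq_diff_eq)
  also have "\<dots> = Poly_Mapping.lookup A (\<kappa> - \<nu>) * base_const c"
    by (auto simp: in_keys_iff)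
  finally show ?thesis .
qed

lemma lookup_d_mult_function:
  "Poly_Mapping.lookup (d_mult (Poly_Mapping.single 0 u) A) \<kappa> = u * Poly_Mapping.lookup A \<kappa>"
proof (cases "u = 0")
  case True
  show ?thesis unfolding True by (simp add: d_mult_def)
next
  case False
  have "Poly_Mapping.lookup (d_mult (Poly_Mapping.single 0 u) A) \<kappa> =
      (\<Sum>\<mu> \<in> Poly_Mapping.keys A. if \<mu> = \<kappa> then u * Poly_Mapping.lookup A \<mu> else 0)"
    using False by (auto simp: d_mult_def lookup_sum lookup_single when_def intro!: sum.cong)
  also have "\<dots> = u * Poly_Mapping.lookup A \<kappa>"
    by (auto simp: in_keys_iff)
  finally show ?thesis .
qed

text \<open>Multiplication by a constant multiple of a shift permutes and scales the coefficients, so a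
  left inverse can be read off.\<close>

lemma d_mult_const_cancel:
  fixes A :: "'v::linorder dop"
  assumes "d_mult A (Poly_Mapping.single \<nu> (base_const c)) = Poly_Mapping.single 0 1" "c * c' = 1"
  shows "A = Poly_Mapping.single (- \<nu>) (base_const c')"
proof (rule poly_mapping_eqI)
  fix \<kappa>
  have inv: "base_const c * base_const c' = (1 :: 'v wfrac)"
    using assms(2) by (simp flip: base_const_mult)
  have "Poly_Mapping.lookup A \<kappa> * base_const c = (if \<kappa> = - \<nu> then 1 else 0)"
    using lookup_d_mult_const[of A \<nu> c "\<kappa> + \<nu>"] unfolding assms(1)
    by (auto simp: lookup_one when_def eq_neg_iff_add_eq_0)
  then have "Poly_Mapping.lookup A \<kappa> * (base_const c * base_const c') = (if \<kappa> = - \<nu> then 1 else 0) * base_const c'"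
    by (simp only: mult.assoc[symmetric])
  then show "Poly_Mapping.lookup A \<kappa> = Poly_Mapping.lookup (Poly_Mapping.single (- \<nu>) (base_const c')) \<kappa>"
    by (auto simp: inv lookup_single when_def)
qed

lemma d_mult_function_cancel:
  assumes "d_mult (Poly_Mapping.single 0 u) A = Poly_Mapping.single 0 1"
  shows "A = Poly_Mapping.single 0 (inverse u)"
proof (rule poly_mapping_eqI)
  fix \<kappa>
  have *: "u * Poly_Mapping.lookup A \<kappa> = (if \<kappa> = 0 then 1 else 0)" for \<kappa>
    using lookup_d_mult_function[of u A \<kappa>] unfolding assms by (auto simp: lookup_one when_def)
  have "u \<noteq> 0" using *[of 0] by auto
  then show "Poly_Mapping.lookup A \<kappa> = Poly_Mapping.lookup (Poly_Mapping.single 0 (inverse u)) \<kappa>"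
    using *[of \<kappa>] by (auto simp: lookup_single when_def field_simps)
qed

section \<open>Minuscule monopole operators with a single active node\<close>

definition full_expo :: "('v \<Rightarrow> nat) \<Rightarrow> 'v \<Rightarrow> 'v expo" where
  "full_expo d l = (\<Sum>r = 1..d l. frag_of (l, r))"

text \<open>The subsets that occur for ranks \<open>m\<close> at \<open>i\<close>, full on \<open>S\<close> and zero elsewhere: there is a choice only
  at the node \<open>i\<close>.\<close>

definition one_active :: "'v set \<Rightarrow> ('v \<Rightarrow> nat) \<Rightarrow> 'v \<Rightarrow> 'v set \<Rightarrow> nat set \<Rightarrow> 'v \<Rightarrow> nat set" where
  "one_active V d i S J = (\<lambda>l \<in> V. if l = i then J else if l \<in> S then {1..d l} else {})"

definition one_active_rank :: "('v \<Rightarrow> nat) \<Rightarrow> 'v \<Rightarrow> 'v set \<Rightarrow> nat \<Rightarrow> 'v \<Rightarrow> nat" where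
  "one_active_rank d i S m l = (if l = i then m else if l \<in> S then d l else 0)"

lemma sum_minuscule_subsets:
  assumes "i \<in> V"
  shows "(\<Sum>J \<in> minuscule_subsets V d (one_active_rank d i S m). \<Phi> J) =
    (\<Sum>J | J \<subseteq> {1..d i} \<and> card J = m. \<Phi> (one_active V d i S J))"
proof (rule sum.reindex_bij_witness[of _ "one_active V d i S" "\<lambda>J. J i"])
  fix J assume "J \<in> minuscule_subsets V d (one_active_rank d i S m)"
  then have J: "J \<in> extensional V" "\<And>l. l \<in> V \<Longrightarrow> J l \<subseteq> {1..d l}"
    "\<And>l. l \<in> V \<Longrightarrow> card (J l) = one_active_rank d i S m l"
    by (auto simp: minuscule_subsets_def PiE_def)
  show "J i \<in> {J. J \<subseteq> {1..d i} \<and> card J = m}"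
    using J(2,3)[OF assms] by (simp add: one_active_rank_def)
  have "one_active V d i S (J i) l = J l" for l
  proof (cases "l \<in> V")
    case True
    have "finite (J l)" using J(2)[OF True] finite_subset by blast
    then have "J l = {}" if "l \<noteq> i" "l \<notin> S"
      using J(3)[OF True] that by (simp add: one_active_rank_def)
    moreover have "J l = {1..d l}" if "l \<noteq> i" "l \<in> S"
      using J(2,3)[OF True] that by (intro card_subset_eq) (simp_all add: one_active_rank_def)
    ultimately show ?thesis
      using True by (simp add: one_active_def)
  qed (use J(1) in \<open>simp add: one_active_def extensional_def\<close>)
  then have eq: "one_active V d i S (J i) = J" by (rule ext)
  show "one_active V d i S (J i) = J" "\<Phi> (one_active V d i S (J i)) = \<Phi> J"
    unfolding eq by (rule refl)+
next
  fix J assume "J \<in> {J. J \<subseteq> {1..d i} \<and> card J = m}"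
  then show "one_active V d i S J \<in> minuscule_subsets V d (one_active_rank d i S m)"
    "one_active V d i S J i = J"
    using assms by (auto simp: one_active_def one_active_rank_def minuscule_subsets_def)
qed

lemma prod_one_active:
  fixes \<psi> :: "'v \<Rightarrow> nat set \<Rightarrow> 'b::comm_monoid_mult"
  assumes "finite V" "i \<in> V" "\<And>l. \<psi> l {} = 1" "\<And>l. \<psi> l {1..d l} = 1"
  shows "(\<Prod>l \<in> V. \<psi> l (one_active V d i S J l)) = \<psi> i J"
proof -
  have "(\<Prod>l \<in> V. \<psi> l (one_active V d i S J l)) = (\<Prod>l \<in> V. if l = i then \<psi> i J else 1)"
    by (rule prod.cong) (use assms(3,4) in \<open>auto simp: one_active_def\<close>)
  then show ?thesis using assms(1,2) by simp
qed

lemma sum_one_active: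
  assumes "finite V" "i \<in> V" "S \<subseteq> V - {i}"
  shows "(\<Sum>l \<in> V. \<Sum>r \<in> one_active V d i S J l. frag_of (l, r)) =
    (\<Sum>r \<in> J. frag_of (i, r)) + (\<Sum>l \<in> S. full_expo d l)"
proof -
  have "(\<Sum>l \<in> V - {i}. \<Sum>r \<in> one_active V d i S J l. frag_of (l, r)) =
      (\<Sum>l \<in> V - {i}. if l \<in> S then full_expo d l else 0)"
    by (rule sum.cong) (auto simp: one_active_def full_expo_def)
  also have "\<dots> = (\<Sum>l \<in> S. full_expo d l)"
    using assms by (subst sum.inter_restrict[symmetric]) (auto simp: Int_absorb1)
  finally show ?thesis
    using assms by (subst sum.remove[of _ i]) (auto simp: one_active_def)
qed

lemma dressing_value_one [simp]: "dressing_value d l J 1 = 1"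
  by (simp add: dressing_value_def)

text \<open>The factors of an arrow are indexed by elements of the subset at one end and of the complement of the
  subset at the other end, so one of these sets being empty makes the product trivial.\<close>

lemma one_active_empty_or_full:
  assumes "J \<subseteq> {1..d i}" "card J = m" "k \<in> V" "l \<in> V"
    "one_active_rank d i S m k = 0 \<or> one_active_rank d i S m l = d l"
  shows "one_active V d i S J k = {} \<or> {1..d l} - one_active V d i S J l = {}"
proof -
  have J: "finite J" using assms(1) finite_subset by blast
  have full: "J = {1..d i}" if "m = d i"
    using assms(1,2) that by (intro card_subset_eq) simp_all
  have empty: "J = {}" if "m = 0"
    using J assms(2) that by simp
  from assms(5) show ?thesis
  proof
    assume "one_active_rank d i S m k = 0"
    then have "one_active V d i S J k = {}"
      using empty assms(3) by (cases "k = i"; cases "k \<in> S"; simp add: one_active_def one_active_rank_def)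
    then show ?thesis ..
  next
    assume "one_active_rank d i S m l = d l"
    then have "{1..d l} \<subseteq> one_active V d i S J l"
      using full assms(4) by (cases "l = i"; cases "l \<in> S"; simp add: one_active_def one_active_rank_def)
    then show ?thesis by blast
  qed
qed

text \<open>At nodes of rank zero or of full rank all factors are empty products, and the assumption on the arrows
  removes their factors as well.\<close>

lemma E_op_one_active:
  fixes G :: "('v::linorder, 'a) pre_digraph"
  assumes "wf_digraph G" "finite (verts G)" "i \<in> verts G" "S \<subseteq> verts G - {i}"
    and arcs: "\<And>a. a \<in> arcs G \<Longrightarrow> one_active_rank d i S m (tail G a) = 0 \<or>
      one_active_rank d i S m (head G a) = d (head G a)"
  shows "E_op G d (one_active_rank d i S m) (\<lambda>l. if l = i then g else 1) =
    (\<Sum>J | J \<subseteq> {1..d i} \<and> card J = m.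
       Poly_Mapping.single ((\<Sum>r \<in> J. frag_of (i, r)) + (\<Sum>l \<in> S. full_expo d l))
         (dressing_value d i J g * (\<Prod>r \<in> J. \<Prod>s \<in> {1..d i} - J. 1 / (1 - w i s * inverse (w i r)))))"
  unfolding E_op_def sum_minuscule_subsets[OF assms(3)]
proof (intro sum.cong refl arg_cong2[where f = Poly_Mapping.single], goal_cases)
  case (1 J)
  show ?case by (rule sum_one_active) (use assms in auto)
next
  case (2 J)
  let ?J = "one_active (verts G) d i S J"
  have "(\<Prod>a \<in> arcs G. \<Prod>r \<in> ?J (tail G a). \<Prod>s \<in> {1..d (head G a)} - ?J (head G a).
      1 - qq * w (tail G a) r * inverse (w (head G a) s)) = (1 :: 'v wfrac)"
  proof (intro prod.neutral ballI, goal_cases)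
    case (1 a r s)
    then show ?case
      using one_active_empty_or_full[of J d i m "tail G a" "verts G" "head G a" S] 2 arcs
        wf_digraph.tail_in_verts[OF assms(1)] wf_digraph.head_in_verts[OF assms(1)] by auto
  qed
  moreover have "(\<Prod>l \<in> verts G. dressing_value d l (?J l) (if l = i then g else 1)) = (dressing_value d i J g :: 'v wfrac)"
  proof -
    have "(\<Prod>l \<in> verts G. dressing_value d l (?J l) (if l = i then g else 1)) =
        (\<Prod>l \<in> verts G. if l = i then dressing_value d i J g else (1 :: 'v wfrac))"
      by (rule prod.cong) (auto simp: one_active_def)
    then show ?thesis using assms by simp
  qed
  moreover have "(\<Prod>l \<in> verts G. \<Prod>r \<in> ?J l. \<Prod>s \<in> {1..d l} - ?J l. 1 / (1 - w l s * inverse (w l r))) =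
      (\<Prod>r \<in> J. \<Prod>s \<in> {1..d i} - J. 1 / (1 - w i s * inverse (w i r) :: 'v wfrac))"
    by (rule prod_one_active[where \<psi> = "\<lambda>l J. \<Prod>r \<in> J. \<Prod>s \<in> {1..d l} - J. 1 / (1 - w l s * inverse (w l r))"])
       (use assms in auto)
  ultimately show ?case by simp
qed

text \<open>As for \<open>E_op\<close>, with the orientation of the arrows and the sign of the shifts reversed.\<close>

lemma F_op_one_active:
  fixes G :: "('v::linorder, 'a) pre_digraph"
  assumes "wf_digraph G" "finite (verts G)" "i \<in> verts G" "S \<subseteq> verts G - {i}"
    and arcs: "\<And>a. a \<in> arcs G \<Longrightarrow> one_active_rank d i S m (head G a) = 0 \<or>
      one_active_rank d i S m (tail G a) = d (tail G a)"
  shows "F_op G d (one_active_rank d i S m) (\<lambda>l. if l = i then g else 1) =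
    (\<Sum>J | J \<subseteq> {1..d i} \<and> card J = m.
       Poly_Mapping.single (- ((\<Sum>r \<in> J. frag_of (i, r)) + (\<Sum>l \<in> S. full_expo d l)))
         (dressing_value d i J g * (\<Prod>r \<in> J. \<Prod>s \<in> {1..d i} - J. 1 / (1 - w i r * inverse (w i s)))))"
  unfolding F_op_def sum_minuscule_subsets[OF assms(3)]
proof (intro sum.cong refl arg_cong2[where f = Poly_Mapping.single], goal_cases)
  case (1 J)
  show ?case using sum_one_active[OF assms(2-4)] by simp
next
  case (2 J)
  let ?J = "one_active (verts G) d i S J"
  have "(\<Prod>a \<in> arcs G. \<Prod>r \<in> ?J (head G a). \<Prod>s \<in> {1..d (tail G a)} - ?J (tail G a).
      1 - qq * w (tail G a) s * inverse (w (head G a) r)) = (1 :: 'v wfrac)"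
  proof (intro prod.neutral ballI, goal_cases)
    case (1 a r s)
    then show ?case
      using one_active_empty_or_full[of J d i m "head G a" "verts G" "tail G a" S] 2 arcs
        wf_digraph.tail_in_verts[OF assms(1)] wf_digraph.head_in_verts[OF assms(1)] by auto
  qed
  moreover have "(\<Prod>l \<in> verts G. dressing_value d l (?J l) (if l = i then g else 1)) = (dressing_value d i J g :: 'v wfrac)"
  proof -
    have "(\<Prod>l \<in> verts G. dressing_value d l (?J l) (if l = i then g else 1)) =
        (\<Prod>l \<in> verts G. if l = i then dressing_value d i J g else (1 :: 'v wfrac))"
      by (rule prod.cong) (auto simp: one_active_def)
    then show ?thesis using assms by simp
  qed
  moreover have "(\<Prod>l \<in> verts G. \<Prod>r \<in> ?J l. \<Prod>s \<in> {1..d l} - ?J l. 1 / (1 - w l r * inverse (w l s))) =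
      (\<Prod>r \<in> J. \<Prod>s \<in> {1..d i} - J. 1 / (1 - w i r * inverse (w i s) :: 'v wfrac))"
    by (rule prod_one_active[where \<psi> = "\<lambda>l J. \<Prod>r \<in> J. \<Prod>s \<in> {1..d l} - J. 1 / (1 - w l r * inverse (w l s))"])
       (use assms in auto)
  ultimately show ?case by simp
qed

text \<open>The dressing \<open>s\<close> times the inverse of the product of the variables with index in \<open>B\<close>. The integer \<open>s\<close> will
  be a sign.\<close>

definition inverse_block :: "nat set \<Rightarrow> int \<Rightarrow> dressing" where
  "inverse_block B s = Poly_Mapping.single (- (\<Sum>r \<in> B. frag_of r)) s"

text \<open>A permutation that maps the block to itself fixes the only exponent vector of this dressing, and so
  does its inverse; hence no other exponent vector is sent to this one.\<close>

lemma inverse_block_in_dressings: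
  assumes "B \<subseteq> {1..D}" "\<And>\<pi>. \<pi> permutes {1..D} \<Longrightarrow> \<pi> ` {1..n} = {1..n} \<Longrightarrow> \<pi> ` B = B"
  shows "inverse_block B s \<in> dressings D n"
proof -
  let ?\<nu> = "- (\<Sum>r \<in> B. frag_of r) :: nat \<Rightarrow>\<^sub>0 int"
  have B: "finite B" using assms(1) finite_subset by blast
  have fixed: "frag_extend (\<lambda>m. frag_of (\<pi> m)) ?\<nu> = ?\<nu>" if "inj \<pi>" "\<pi> ` B = B" for \<pi>
  proof -
    have "frag_extend (\<lambda>m. frag_of (\<pi> m)) ?\<nu> = - (\<Sum>r \<in> B. frag_of (\<pi> r))"
      using B by (simp add: frag_extend_minus frag_extend_sum)
    also have "(\<Sum>r \<in> B. frag_of (\<pi> r)) = (\<Sum>r \<in> \<pi> ` B. frag_of r :: nat \<Rightarrow>\<^sub>0 int)"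
      using inj_on_subset[OF that(1) subset_UNIV, of B] by (simp add: sum.reindex)
    finally show ?thesis using that(2) by simp
  qed
  have sym: "frag_extend (\<lambda>m. frag_of (\<pi> m)) \<kappa> = ?\<nu> \<longleftrightarrow> \<kappa> = ?\<nu>"
    if \<pi>: "\<pi> permutes {1..D}" "\<pi> ` {1..n} = {1..n}" for \<pi> and \<kappa> :: "nat \<Rightarrow>\<^sub>0 int"
  proof
    have inj: "inj \<pi>" using \<pi>(1) by (rule permutes_inj)
    have \<pi>B: "\<pi> ` B = B" using assms(2) \<pi> by blast
    show "frag_extend (\<lambda>m. frag_of (\<pi> m)) \<kappa> = ?\<nu>" if "\<kappa> = ?\<nu>"
      unfolding that by (rule fixed[OF inj \<pi>B])
    have "inv_into UNIV \<pi> ` B = B"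
      using image_inv_f_f[OF inj, of B] \<pi>B by simp
    then have "frag_extend (\<lambda>m. frag_of (inv_into UNIV \<pi> m)) ?\<nu> = ?\<nu>"
      by (rule fixed[OF permutes_inj[OF permutes_inv[OF \<pi>(1)]]])
    moreover have "frag_extend (\<lambda>m. frag_of (inv_into UNIV \<pi> m)) (frag_extend (\<lambda>m. frag_of (\<pi> m)) \<kappa>) = \<kappa>"
      using frag_extend_compose[of "\<lambda>m. frag_of (inv_into UNIV \<pi> m)" \<pi> \<kappa>]
      by (simp add: o_def inv_f_f[OF inj] flip: frag_expansion)
    moreover assume "frag_extend (\<lambda>m. frag_of (\<pi> m)) \<kappa> = ?\<nu>"
    ultimately show "\<kappa> = ?\<nu>" by metis
  qed
  have "Poly_Mapping.keys ?\<nu> \<subseteq> {1..D}"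
    using keys_sum[of "frag_of :: nat \<Rightarrow> _" B] assms(1) by auto
  then have "\<forall>\<nu> \<in> Poly_Mapping.keys (Poly_Mapping.single ?\<nu> s). Poly_Mapping.keys \<nu> \<subseteq> {1..D}"
    by (simp only: keys_single) auto
  moreover have "Poly_Mapping.lookup (Poly_Mapping.single ?\<nu> s) (frag_extend (\<lambda>m. frag_of (\<pi> m)) \<kappa>) =
      Poly_Mapping.lookup (Poly_Mapping.single ?\<nu> s) \<kappa>"
    if "\<pi> permutes {1..D} \<and> \<pi> ` {1..n} = {1..n}" for \<pi> \<kappa>
  proof -
    have "(?\<nu> = frag_extend (\<lambda>m. frag_of (\<pi> m)) \<kappa>) = (?\<nu> = \<kappa>)"
      using sym[OF conjunct1[OF that] conjunct2[OF that], of \<kappa>] by argo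
    then show ?thesis unfolding lookup_single by (rule arg_cong)
  qed
  ultimately show ?thesis
    unfolding dressings_def inverse_block_def by blast
qed

lemma w_neq_0 [simp]: "w i r \<noteq> 0"
  by (simp add: w_def)

lemma prod_inverse_w:
  assumes "finite B"
  shows "(\<Prod>r \<in> B. inverse (w l (\<sigma> r))) = emb (Poly_Mapping.single (- (\<Sum>r \<in> B. frag_of (l, \<sigma> r))) 1)"
  using assms
proof induction
  case (insert r B)
  have "emb (Poly_Mapping.single (- frag_of (l, \<sigma> r)) 1) * w l (\<sigma> r) = 1"
    by (simp add: w_def mult_single flip: emb_mult)
  then have "inverse (w l (\<sigma> r)) = emb (Poly_Mapping.single (- frag_of (l, \<sigma> r)) 1)"
    by (metis inverse_unique mult.commute)
  then show ?case
    using insert by (simp add: mult_single add.commute flip: emb_mult)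
qed simp

lemma dressing_value_inverse_block:
  assumes "finite B" "s \<noteq> 0"
  shows "dressing_value d l J (inverse_block B s) =
    base_const (Poly_Mapping.single 0 s) * (\<Prod>r \<in> B. inverse (w l ((sorted_list_of_set J @ sorted_list_of_set ({1..d l} - J)) ! (r - 1))))"
  using assms unfolding prod_inverse_w[OF assms(1)]
  by (simp add: dressing_value_def inverse_block_def Let_def frag_extend_minus frag_extend_sum
      o_def base_const_def mult_single flip: emb_mult)

lemma dressing_value_first_block:
  assumes "J \<subseteq> {1..d l}" "card J = n" "s \<noteq> 0"
  shows "dressing_value d l J (inverse_block {1..n} s) =
    base_const (Poly_Mapping.single 0 s) * (\<Prod>r \<in> J. inverse (w l r))"
proof -
  let ?js = "sorted_list_of_set J @ sorted_list_of_set ({1..d l} - J)"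
  have J: "finite J" using assms(1) finite_subset by blast
  have "(\<Prod>r \<in> {1..n}. inverse (w l (?js ! (r - 1)))) = (\<Prod>k<n. inverse (w l (sorted_list_of_set J ! k)))"
    by (rule prod.reindex_bij_witness[of _ Suc "\<lambda>r. r - 1"]) (use assms J in \<open>auto simp: nth_append\<close>)
  also have "\<dots> = (\<Prod>r \<in> J. inverse (w l r))"
    using bij_betw_nth[of "sorted_list_of_set J" "{..<n}" J] J assms(2)
    by (intro prod.reindex_bij_betw) simp
  finally show ?thesis using assms(3) by (simp add: dressing_value_inverse_block)
qed

lemma dressing_value_second_block:
  assumes "J \<subseteq> {1..d l}" "card J = n" "s \<noteq> 0"
  shows "dressing_value d l J (inverse_block {n<..d l} s) =
    base_const (Poly_Mapping.single 0 s) * (\<Prod>r \<in> {1..d l} - J. inverse (w l r))"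
proof -
  let ?js = "sorted_list_of_set J @ sorted_list_of_set ({1..d l} - J)"
  have J: "finite J" using assms(1) finite_subset by blast
  then have len: "length (sorted_list_of_set J) = n" "card ({1..d l} - J) = d l - n"
    using assms by (auto simp: card_Diff_subset)
  have "(\<Prod>r \<in> {n<..d l}. inverse (w l (?js ! (r - 1)))) = (\<Prod>k<d l - n. inverse (w l (?js ! (n + k))))"
    by (rule prod.reindex_bij_witness[of _ "\<lambda>k. n + k + 1" "\<lambda>r. r - 1 - n"]) auto
  also have "\<dots> = (\<Prod>k<d l - n. inverse (w l (sorted_list_of_set ({1..d l} - J) ! k)))"
    by (simp only: len(1)[symmetric] nth_append_length_plus)
  also have "\<dots> = (\<Prod>r \<in> {1..d l} - J. inverse (w l r))"
    using bij_betw_nth[of "sorted_list_of_set ({1..d l} - J)" "{..<d l - n}" "{1..d l} - J"] len(2)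
    by (intro prod.reindex_bij_betw) simp
  finally show ?thesis using assms(3) by (simp add: dressing_value_inverse_block)
qed

section \<open>Images of monomials supported at a single node\<close>

text \<open>The common part of the vectors of the dual basis at their active node; \<open>b\<close> tells whether
  the \<open>p\<close>-variables are involved. For \<open>m = 0\<close> it includes \<open>0\<close> and \<open>- p_fund i (d i)\<close>, for \<open>m = d i\<close> the
  full vector \<open>x_fund i (d i)\<close>.\<close>

definition node_base :: "('v \<Rightarrow> nat) \<Rightarrow> 'v \<Rightarrow> bool \<Rightarrow> nat \<Rightarrow> 'v lat" where
  "node_base d i b m = x_fund i m + (if b then p_fund i m - p_fund i (d i) else 0)"

lemma node_base_in_lattice: "m \<le> d i \<Longrightarrow> i \<in> V \<Longrightarrow> node_base d i b m \<in> lattice V d"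
  by (auto simp: node_base_def intro!: lattice_closed fund_in_lattice)

lemma lookup_node_base:
  "Poly_Mapping.lookup (node_base d i b m) (X j r) = (if i = j \<and> 1 \<le> r \<and> r \<le> m then 1 else 0)"
  "m \<le> d i \<Longrightarrow> Poly_Mapping.lookup (node_base d i b m) (P j r) =
    (if b \<and> i = j \<and> 1 \<le> r \<and> r \<le> d i \<and> m < r then - 1 else 0)"
  by (auto simp: node_base_def lookup_add lookup_minus lookup_x_fund lookup_p_fund)

lemma Y_in_node_laurent:
  assumes "\<kappa> \<in> lattice {i} d"
    and "\<And>r. 1 \<le> r \<Longrightarrow> r < d i \<Longrightarrow> form (e_s i r) \<kappa> \<in> {0, 1} \<and> form (e_t i r) \<kappa> \<in> {0, 1}"
  shows "Y \<kappa> \<in> node_laurent d i"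
  unfolding node_laurent_def
proof (rule Y_in_univ_laurent)
  show "node_seed d i \<subseteq> lattice {i} d" by (rule node_seed_in_lattice) simp
  fix e assume "e \<in> node_seed d i"
  then obtain r where "1 \<le> r" "r < d i" "e = e_s i r \<or> e = e_t i r" by (auto simp: node_seed_def)
  then show "form e \<kappa> = 0 \<or> form e \<kappa> = 1" using assms(2)[of r] by blast
qed (rule assms(1))

lemma node_elements:
  assumes "m \<le> d i"
  shows "Y (node_base d i b m) \<in> node_laurent d i"
    and "Y (node_base d i b m - x_fund i (d i)) \<in> node_laurent d i"
    and "Y (x_fund i (d i)) \<in> node_laurent d i"
    and "Y (- x_fund i (d i)) \<in> node_laurent d i"
    and "Y (p_fund i (d i)) \<in> node_laurent d i"
    and "Y (- p_fund i (d i)) \<in> node_laurent d i"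
    and "Y (p_fund i m + x_fund i m) \<in> node_laurent d i"
    and "Y 0 \<in> node_laurent d i"
  by (rule Y_in_node_laurent;
      use assms in \<open>auto simp: form_e_s form_e_t lookup_minus lookup_add lookup_node_base lookup_x_fund lookup_p_fund
        intro!: node_base_in_lattice lattice_closed fund_in_lattice\<close>)+

lemma qalg_homD:
  assumes "h \<in> qalg_hom A B"
  shows "\<And>a b. a \<in> A \<Longrightarrow> b \<in> A \<Longrightarrow> h (qt_mult a b) = d_mult (h a) (h b)"
    and "h (Y 0) = Poly_Mapping.single 0 1"
    and "\<And>c a. a \<in> A \<Longrightarrow> h (qt_scale c a) = d_scale (base_const c) (h a)"
  using assms by (auto simp: qalg_hom_def ring_hom_def qtorus_def dops_def)

text \<open>The scalars that arise from reordering products in the quantum torus and from the normalization of the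
  isomorphism.\<close>

definition q_unit :: "'v::linorder wfrac \<Rightarrow> bool" where
  "q_unit u \<longleftrightarrow> (\<exists>k. u = qq powi k \<or> u = - (qq powi k))"

lemma qq_neq_0 [simp]: "qq \<noteq> 0"
  by (simp add: qq_def base_const_def qpow_def)

lemma q_unit_powi [simp]: "q_unit (qq powi k)"
  by (auto simp: q_unit_def)

lemma q_unit_one [simp]: "q_unit 1"
  using q_unit_powi[of 0] by simp

lemma q_unit_mult [intro]: "q_unit a \<Longrightarrow> q_unit b \<Longrightarrow> q_unit (a * b)"
  unfolding q_unit_def by (auto simp flip: power_int_add)

lemma q_unit_minus_q_pow [simp]: "q_unit (base_const (minus_q_pow k))"
  by (auto simp: q_unit_def minus_q_pow_def base_const_minus base_const_qpow)

lemma q_unit_neg_power [simp]: "q_unit ((- qq) ^ n)"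
proof (induction n)
  case (Suc n)
  have "q_unit (- qq)" unfolding q_unit_def by (auto intro!: exI[of _ 1])
  from q_unit_mult[OF this Suc.IH] show ?case by simp
qed simp

text \<open>The dressed monopole operator of a single node, multiplied from the right by the shift \<open>\<nu>\<close>.\<close>

definition shifted_monopole :: "('v \<Rightarrow> nat) \<Rightarrow> 'v::linorder \<Rightarrow> nat \<Rightarrow> (nat set \<Rightarrow> 'v wfrac) \<Rightarrow> 'v expo \<Rightarrow> 'v dop" where
  "shifted_monopole d i m g \<nu> = (\<Sum>J | J \<subseteq> {1..d i} \<and> card J = m.
     Poly_Mapping.single ((\<Sum>r \<in> J. frag_of (i, r)) + \<nu>)
       ((\<Prod>r \<in> J. \<Prod>s \<in> {1..d i} - J. 1 / (1 - w i s / w i r)) * g J))"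

lemma shifted_monopole_0: "shifted_monopole d i m g 0 = node_monopole d i m g"
  by (simp add: shifted_monopole_def node_monopole_def)

lemma shifted_monopole_cong:
  "(\<And>J. J \<subseteq> {1..d i} \<Longrightarrow> card J = m \<Longrightarrow> g J = g' J) \<Longrightarrow> shifted_monopole d i m g \<nu> = shifted_monopole d i m g' \<nu>"
  unfolding shifted_monopole_def by (intro sum.cong refl arg_cong2[where f = Poly_Mapping.single]) auto

lemma shifted_monopole_rank_0: "shifted_monopole d i 0 g \<nu> = Poly_Mapping.single \<nu> (g {})"
proof -
  have "{J. J \<subseteq> {1..d i} \<and> card J = 0} = {{}}" by (auto dest: finite_subset)
  then show ?thesis by (simp add: shifted_monopole_def)
qed

lemma subsets_of_full_card: "{J. J \<subseteq> {1..n} \<and> card J = n} = {{1..n}}"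
proof -
  have "J = {1..n}" if "J \<subseteq> {1..n}" "card J = n" for J
    using that by (intro card_subset_eq) auto
  then show ?thesis by auto
qed

lemma shifted_monopole_full: "shifted_monopole d i (d i) g \<nu> = Poly_Mapping.single (full_expo d i + \<nu>) (g {1..d i})"
  unfolding shifted_monopole_def subsets_of_full_card by (simp add: full_expo_def)

lemma d_scale_shifted_monopole:
  "d_scale c (shifted_monopole d i m g \<nu>) = shifted_monopole d i m (\<lambda>J. c * g J) \<nu>"
  by (rule poly_mapping_eqI)
     (simp add: shifted_monopole_def lookup_sum lookup_single when_def sum_distrib_left mult_ac if_distrib cong: if_cong)

lemma d_mult_function_shifted_monopole:
  "d_mult (Poly_Mapping.single 0 c) (shifted_monopole d i m g \<nu>) = shifted_monopole d i m (\<lambda>J. c * g J) \<nu>"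
  unfolding d_scale_shifted_monopole[symmetric] by (rule poly_mapping_eqI) (simp add: lookup_d_mult_function)

lemma d_mult_shifted_monopole_const:
  "d_mult (shifted_monopole d i m g \<nu>) (Poly_Mapping.single \<nu>' (base_const c)) =
     shifted_monopole d i m (\<lambda>J. base_const c * g J) (\<nu> + \<nu>')"
proof (rule poly_mapping_eqI)
  fix \<kappa>
  have "((\<Sum>r \<in> J. frag_of (i, r)) + \<nu> = \<kappa> - \<nu>') = ((\<Sum>r \<in> J. frag_of (i, r)) + (\<nu> + \<nu>') = \<kappa>)" for J
    by (auto simp: algebra_simps)
  then show "Poly_Mapping.lookup (d_mult (shifted_monopole d i m g \<nu>) (Poly_Mapping.single \<nu>' (base_const c))) \<kappa> =
      Poly_Mapping.lookup (shifted_monopole d i m (\<lambda>J. base_const c * g J) (\<nu> + \<nu>')) \<kappa>"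
    unfolding lookup_d_mult_const shifted_monopole_def lookup_sum lookup_single when_def sum_distrib_right
    by (intro sum.cong) auto
qed

lemma hamiltonian_full: "hamiltonian d i (d i) = Y (p_fund i (d i))"
proof -
  have no_steps: "{m. 1 \<le> m \<and> m < d i \<and> m \<notin> {1..d i} \<and> m + 1 \<in> {1..d i}} = {}"
    by auto
  have "hamiltonian d i (d i) = qt_mult (Y (p_fund i (d i))) (Y 0) + 0"
    unfolding hamiltonian_def subsets_of_full_card p_fund_def
    by (simp only: sum.insert finite.emptyI empty_iff not_False_eq_True sum.empty no_steps
        sorted_list_of_set_empty foldr.simps id_apply)
  then show ?thesis by (simp add: qt_mult_Y_orthogonal)
qed

lemma elem_sym_full: "elem_sym d i (d i) = Poly_Mapping.single 0 (\<Prod>r \<in> {1..d i}. w i r)"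
  unfolding elem_sym_def subsets_of_full_card by simp

locale node_isomorphism =
  fixes d :: "'v::linorder \<Rightarrow> nat" and i :: 'v and W :: "'v qtor \<Rightarrow> 'v dop"
  assumes node_iso: "node_iso d i W" and dim: "d i \<ge> 1"
begin

lemma hom: "W \<in> qalg_hom (node_laurent d i) (D_res d i)"
  using node_iso by (simp add: node_iso_def qalg_iso_def)

lemmas W_mult = qalg_homD(1)[OF hom] and W_one = qalg_homD(2)[OF hom] and W_scale = qalg_homD(3)[OF hom]

text \<open>Membership of the product \<open>Y (\<kappa> + \<mu>)\<close> is used instead of that of \<open>qt_mult (Y \<kappa>) (Y \<mu>)\<close>: the latter is a
  scalar multiple of the former, and the homomorphism is linear.\<close>

lemma W_Y_add:
  assumes "Y \<kappa> \<in> node_laurent d i" "Y \<mu> \<in> node_laurent d i" "Y (\<kappa> + \<mu>) \<in> node_laurent d i"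
  shows "W (Y (\<kappa> + \<mu>)) = d_scale (base_const (minus_q_pow (form \<kappa> \<mu>))) (d_mult (W (Y \<kappa>)) (W (Y \<mu>)))"
proof -
  have "qt_mult (Y \<kappa>) (Y \<mu>) = qt_scale (minus_q_pow (- form \<kappa> \<mu>)) (Y (\<kappa> + \<mu>))"
    unfolding qt_mult_Y by (simp add: qt_scale_def Y_def)
  then have "d_mult (W (Y \<kappa>)) (W (Y \<mu>)) = d_scale (base_const (minus_q_pow (- form \<kappa> \<mu>))) (W (Y (\<kappa> + \<mu>)))"
    using assms W_mult W_scale by metis
  moreover have "base_const (minus_q_pow (form \<kappa> \<mu>)) * base_const (minus_q_pow (- form \<kappa> \<mu>)) = (1 :: 'v wfrac)"
    by (simp flip: base_const_mult minus_q_pow_add)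
  ultimately show ?thesis
    by (intro poly_mapping_eqI) (simp flip: mult.assoc)
qed

text \<open>The full vector is mapped to a multiple of the product of all \<open>D\<close>-variables, whose inverse is then the
  image of the opposite vector.\<close>

lemma W_x_full:
  obtains k where "W (Y (x_fund i (d i))) = Poly_Mapping.single (full_expo d i) (base_const (qpow k))"
    "W (Y (- x_fund i (d i))) = Poly_Mapping.single (- full_expo d i) (base_const (qpow (- k)))"
proof -
  define k where "k = - int (d i * (d i - 1) div 2)"
  have 1: "W (Y (x_fund i (d i))) = Poly_Mapping.single (full_expo d i) (base_const (qpow k))"
    using node_iso dim unfolding node_iso_def k_def base_const_qpow
    by (simp add: d_scale_shifted_monopole shifted_monopole_full flip: shifted_monopole_0)
  have "d_mult (W (Y (- x_fund i (d i)))) (W (Y (x_fund i (d i)))) = W (Y (- x_fund i (d i) + x_fund i (d i)))"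
    using node_elements[of "d i" d i] by (simp add: form_minus_left form_self W_mult[symmetric] qt_mult_Y_orthogonal)
  then have "d_mult (W (Y (- x_fund i (d i)))) (Poly_Mapping.single (full_expo d i) (base_const (qpow k))) = Poly_Mapping.single 0 1"
    by (simp add: 1 W_one)
  then have "W (Y (- x_fund i (d i))) = Poly_Mapping.single (- full_expo d i) (base_const (qpow (- k)))"
    by (rule d_mult_const_cancel) (simp flip: qpow_add)
  then show ?thesis using that 1 by blast
qed

text \<open>The vector \<open>p_fund i (d i)\<close> belongs to the top Hamiltonian, which is mapped to a function without shifts.\<close>

lemma W_p_full_inverse:
  "W (Y (- p_fund i (d i))) = Poly_Mapping.single 0 (inverse (\<Prod>r \<in> {1..d i}. w i r))"
proof (rule d_mult_function_cancel)
  have "W (Y (p_fund i (d i))) = Poly_Mapping.single 0 (\<Prod>r \<in> {1..d i}. w i r)"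
    using node_iso dim unfolding node_iso_def hamiltonian_full[symmetric] elem_sym_full[symmetric] by simp
  moreover have "d_mult (W (Y (p_fund i (d i)))) (W (Y (- p_fund i (d i)))) = W (Y (p_fund i (d i) + - p_fund i (d i)))"
    using node_elements[of "d i" d i] by (simp add: form_minus_right form_self W_mult[symmetric] qt_mult_Y_orthogonal)
  ultimately show "d_mult (Poly_Mapping.single 0 (\<Prod>r \<in> {1..d i}. w i r)) (W (Y (- p_fund i (d i)))) = Poly_Mapping.single 0 1"
    by (simp add: W_one)
qed

abbreviation dressing_factor :: "bool \<Rightarrow> nat set \<Rightarrow> 'v wfrac" where
  "dressing_factor b J \<equiv> if b then \<Prod>s \<in> {1..d i} - J. inverse (w i s) else 1"

text \<open>In the case with \<open>p\<close>-part the product of the \<open>w i j\<close> over \<open>J\<close> is divided by the product of all of them. The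
  factor \<open>Y (- p_fund i (d i))\<close> is put on the left, so that the function it is mapped to is not
  affected by the shifts.\<close>

lemma W_node_base:
  assumes "m \<le> d i"
  obtains u where "q_unit u" "W (Y (node_base d i b m)) = shifted_monopole d i m (\<lambda>J. u * dressing_factor b J) 0"
proof (cases b)
  case False
  show ?thesis
  proof (cases "m = 0")
    case True
    then show ?thesis using that[of 1] False W_one by (simp add: node_base_def shifted_monopole_rank_0)
  next
    case m: False
    then have "W (Y (node_base d i b m)) = shifted_monopole d i m (\<lambda>J. qq powi (- int (m * (m - 1) div 2)) * dressing_factor b J) 0"
      using node_iso assms False unfolding node_iso_def
      by (simp add: node_base_def d_scale_shifted_monopole flip: shifted_monopole_0)
    then show ?thesis by (rule that[rotated]) simp
  qed
next
  case True
  let ?M = "p_fund i m + x_fund i m"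
  obtain v where v: "q_unit v" "W (Y ?M) = shifted_monopole d i m (\<lambda>J. v * (\<Prod>j \<in> J. w i j)) 0"
  proof (cases "m = 0")
    case True
    then show ?thesis using that[of 1] W_one by (simp add: shifted_monopole_rank_0)
  next
    case False
    then have "W (Y ?M) = shifted_monopole d i m (\<lambda>J. ((- qq) ^ m * qq powi (- int (m * (m - 1) div 2))) * (\<Prod>j \<in> J. w i j)) 0"
      using node_iso assms unfolding node_iso_def
      by (simp add: d_scale_shifted_monopole flip: shifted_monopole_0)
    then show ?thesis by (rule that[rotated]) auto
  qed
  \<comment> \<open>the scalar in front of \<open>?M\<close>, corrected by the reordering of the factors\<close>
  let ?u = "base_const (minus_q_pow (form (- p_fund i (d i)) ?M)) * v"
  have "W (Y (node_base d i b m)) = W (Y (- p_fund i (d i) + ?M))"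
    using True by (simp add: node_base_def algebra_simps)
  also have "\<dots> = d_scale (base_const (minus_q_pow (form (- p_fund i (d i)) ?M))) (d_mult (W (Y (- p_fund i (d i)))) (W (Y ?M)))"
  proof (rule W_Y_add)
    show "Y (- p_fund i (d i) + ?M) \<in> node_laurent d i"
      using node_elements(1)[of m d i True] assms by (simp add: node_base_def algebra_simps)
  qed (use node_elements[of m d i] assms in auto)
  also have "\<dots> = shifted_monopole d i m (\<lambda>J. ?u * dressing_factor b J) 0"
    unfolding v(2) W_p_full_inverse d_mult_function_shifted_monopole d_scale_shifted_monopole
  proof (rule shifted_monopole_cong)
    fix J assume "J \<subseteq> {1..d i}" "card J = m"
    then have "inverse (\<Prod>r \<in> {1..d i}. w i r) * (\<Prod>j \<in> J. w i j) = (\<Prod>s \<in> {1..d i} - J. inverse (w i s))"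
      using prod.subset_diff[of J "{1..d i}" "w i"] finite_subset[of J "{1..d i}"]
        prod_inversef[of "w i" "{1..d i} - J", symmetric]
      by (simp add: o_def inverse_mult_distrib)
    then show "base_const (minus_q_pow (form (- p_fund i (d i)) ?M)) * (inverse (\<Prod>r \<in> {1..d i}. w i r) * (v * (\<Prod>j \<in> J. w i j)))
        = ?u * dressing_factor b J"
      using True by (simp add: mult_ac)
  qed
  finally show ?thesis by (rule that[rotated]) (use v(1) in auto)
qed

lemma W_node_base_minus_x:
  assumes "m \<le> d i"
  obtains u where "q_unit u" "W (Y (node_base d i b m - x_fund i (d i))) =
    shifted_monopole d i m (\<lambda>J. u * dressing_factor b J) (- full_expo d i)"
proof -
  obtain u where u: "q_unit u" "W (Y (node_base d i b m)) = shifted_monopole d i m (\<lambda>J. u * dressing_factor b J) 0"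
    using W_node_base[OF assms] by metis
  obtain k where k: "W (Y (- x_fund i (d i))) = Poly_Mapping.single (- full_expo d i) (base_const (qpow (- k)))"
    using W_x_full by metis
  let ?c = "minus_q_pow (form (node_base d i b m) (- x_fund i (d i)))"
  have "W (Y (node_base d i b m + - x_fund i (d i))) =
      d_scale (base_const ?c) (d_mult (W (Y (node_base d i b m))) (W (Y (- x_fund i (d i)))))"
    by (rule W_Y_add) (use node_elements[of m d i] assms in auto)
  also have "\<dots> = shifted_monopole d i m (\<lambda>J. (base_const ?c * (base_const (qpow (- k)) * u)) * dressing_factor b J) (- full_expo d i)"
    unfolding u(2) k d_mult_shifted_monopole_const d_scale_shifted_monopole
    by (simp add: mult.assoc)
  finally show ?thesis
    using that[of "base_const ?c * (base_const (qpow (- k)) * u)"] u(1) by (simp add: base_const_qpow q_unit_mult)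
qed

end

section \<open>Images of monomials under the tensor product isomorphism\<close>

lemma generate_ring_qtorus_mult:
  "A \<in> generate_ring qtorus S \<Longrightarrow> B \<in> generate_ring qtorus S \<Longrightarrow> qt_mult A B \<in> generate_ring qtorus S"
  using generate_ring.eng_mult[of A qtorus S B] by (simp add: qtorus_def)

locale quiver_isomorphism =
  fixes G :: "('v::linorder, 'a) pre_digraph" and d :: "'v \<Rightarrow> nat"
    and W :: "'v \<Rightarrow> 'v qtor \<Rightarrow> 'v dop" and WG :: "'v qtor \<Rightarrow> 'v dop"
  assumes fin_quiver: "fin_digraph G"
    and dims: "\<And>i. i \<in> verts G \<Longrightarrow> d i \<ge> 1"
    and node_isos: "\<And>i. i \<in> verts G \<Longrightarrow> node_iso d i (W i)"
    and tensor: "tensor_map (verts G) d W WG"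
begin

sublocale fin_digraph G by (rule fin_quiver)

lemma node: "i \<in> verts G \<Longrightarrow> node_isomorphism d i (W i)"
  using dims node_isos by unfold_locales

lemma tensor_hom: "WG \<in> qalg_hom (tensor_laurent (verts G) d) (tensor_D_res (verts G) d)"
  using tensor by (simp add: tensor_map_def)

lemma node_laurent_subset: "i \<in> verts G \<Longrightarrow> A \<in> node_laurent d i \<Longrightarrow> A \<in> tensor_laurent (verts G) d"
  unfolding tensor_laurent_def by (blast intro: generate_ring.incl)

lemma WG_node: "i \<in> verts G \<Longrightarrow> A \<in> node_laurent d i \<Longrightarrow> WG A = W i A"
  using tensor by (simp add: tensor_map_def)

lemma Y_add_disjoint:
  assumes "\<kappa> \<in> lattice V d" "\<mu> \<in> lattice V' d" "V \<inter> V' = {}"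
    and "Y \<kappa> \<in> tensor_laurent (verts G) d" "Y \<mu> \<in> tensor_laurent (verts G) d"
  shows "Y (\<kappa> + \<mu>) \<in> tensor_laurent (verts G) d" "WG (Y (\<kappa> + \<mu>)) = d_mult (WG (Y \<kappa>)) (WG (Y \<mu>))"
proof -
  have eq: "Y (\<kappa> + \<mu>) = qt_mult (Y \<kappa>) (Y \<mu>)"
    using form_disjoint_nodes[OF assms(1-3)] by (simp add: qt_mult_Y_orthogonal)
  show "Y (\<kappa> + \<mu>) \<in> tensor_laurent (verts G) d"
    unfolding eq using assms(4,5) unfolding tensor_laurent_def by (rule generate_ring_qtorus_mult)
  show "WG (Y (\<kappa> + \<mu>)) = d_mult (WG (Y \<kappa>)) (WG (Y \<mu>))"
    unfolding eq using qalg_homD(1)[OF tensor_hom] assms(4,5) by blast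
qed

text \<open>The exponents are additive over the nodes because monomials at different nodes multiply without
  a power of \<open>q\<close>. Only constants have to be moved past shifts.\<close>

lemma WG_sum_over_nodes:
  assumes "finite S" "S \<subseteq> verts G"
    and "\<And>l. l \<in> S \<Longrightarrow> \<kappa> l \<in> lattice {l} d \<and> Y (\<kappa> l) \<in> node_laurent d l \<and>
      (\<exists>k. W l (Y (\<kappa> l)) = Poly_Mapping.single (\<nu> l) (base_const (qpow k)))"
  shows "(\<Sum>l \<in> S. \<kappa> l) \<in> lattice S d \<and> Y (\<Sum>l \<in> S. \<kappa> l) \<in> tensor_laurent (verts G) d \<and>
    (\<exists>k. WG (Y (\<Sum>l \<in> S. \<kappa> l)) = Poly_Mapping.single (\<Sum>l \<in> S. \<nu> l) (base_const (qpow k)))"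
  using assms
proof (induction S)
  case empty
  have "Y 0 \<in> tensor_laurent (verts G) d"
    using generate_ring.one[of qtorus] by (simp add: tensor_laurent_def qtorus_def)
  then show ?case
    using qalg_homD(2)[OF tensor_hom] by (auto intro!: exI[of _ 0] lattice_closed)
next
  case (insert l S)
  then obtain k where IH: "(\<Sum>l \<in> S. \<kappa> l) \<in> lattice S d" "Y (\<Sum>l \<in> S. \<kappa> l) \<in> tensor_laurent (verts G) d"
    "WG (Y (\<Sum>l \<in> S. \<kappa> l)) = Poly_Mapping.single (\<Sum>l \<in> S. \<nu> l) (base_const (qpow k))"
    by auto
  obtain k' where l: "l \<in> verts G" "\<kappa> l \<in> lattice {l} d" "Y (\<kappa> l) \<in> node_laurent d l"
    "W l (Y (\<kappa> l)) = Poly_Mapping.single (\<nu> l) (base_const (qpow k'))"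
    using insert.prems by auto
  have disj: "{l} \<inter> S = {}" using insert.hyps by auto
  note step = Y_add_disjoint[OF l(2) IH(1) disj node_laurent_subset[OF l(1,3)] IH(2)]
  have "WG (Y (\<kappa> l + (\<Sum>l \<in> S. \<kappa> l))) = Poly_Mapping.single (\<nu> l + (\<Sum>l \<in> S. \<nu> l)) (base_const (qpow (k' + k)))"
    unfolding step(2) IH(3) WG_node[OF l(1,3)] l(4)
    by (rule poly_mapping_eqI)
       (auto simp: lookup_d_mult_const lookup_single when_def qpow_add base_const_mult eq_diff_eq)
  moreover have "\<kappa> l + (\<Sum>l \<in> S. \<kappa> l) \<in> lattice (insert l S) d"
    using l(2) IH(1) by (intro lattice_closed) (auto intro: lattice_mono[rotated])
  ultimately show ?case using step(1) insert.hyps by auto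
qed

lemma WG_full_shift:
  assumes "S \<subseteq> verts G"
  shows "(\<Sum>l \<in> S. x_fund l (d l)) \<in> lattice S d" "Y (\<Sum>l \<in> S. x_fund l (d l)) \<in> tensor_laurent (verts G) d"
    "\<exists>k. WG (Y (\<Sum>l \<in> S. x_fund l (d l))) = Poly_Mapping.single (\<Sum>l \<in> S. full_expo d l) (base_const (qpow k))"
    "(\<Sum>l \<in> S. - x_fund l (d l)) \<in> lattice S d" "Y (\<Sum>l \<in> S. - x_fund l (d l)) \<in> tensor_laurent (verts G) d"
    "\<exists>k. WG (Y (\<Sum>l \<in> S. - x_fund l (d l))) = Poly_Mapping.single (\<Sum>l \<in> S. - full_expo d l) (base_const (qpow k))"
proof -
  have fin: "finite S" using assms finite_verts finite_subset by blast
  have "x_fund l (d l) \<in> lattice {l} d \<and> Y (x_fund l (d l)) \<in> node_laurent d l \<and>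
      (\<exists>k. W l (Y (x_fund l (d l))) = Poly_Mapping.single (full_expo d l) (base_const (qpow k)))"
    "- x_fund l (d l) \<in> lattice {l} d \<and> Y (- x_fund l (d l)) \<in> node_laurent d l \<and>
      (\<exists>k. W l (Y (- x_fund l (d l))) = Poly_Mapping.single (- full_expo d l) (base_const (qpow k)))"
    if "l \<in> S" for l
    using node_isomorphism.W_x_full[OF node, of l] node_elements(3,4)[of "d l" d l] assms that
    by (auto intro!: fund_in_lattice lattice_closed)
  from WG_sum_over_nodes[OF fin assms this(1)] WG_sum_over_nodes[OF fin assms this(2)]
  show "(\<Sum>l \<in> S. x_fund l (d l)) \<in> lattice S d" "Y (\<Sum>l \<in> S. x_fund l (d l)) \<in> tensor_laurent (verts G) d"
    "\<exists>k. WG (Y (\<Sum>l \<in> S. x_fund l (d l))) = Poly_Mapping.single (\<Sum>l \<in> S. full_expo d l) (base_const (qpow k))"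
    "(\<Sum>l \<in> S. - x_fund l (d l)) \<in> lattice S d" "Y (\<Sum>l \<in> S. - x_fund l (d l)) \<in> tensor_laurent (verts G) d"
    "\<exists>k. WG (Y (\<Sum>l \<in> S. - x_fund l (d l))) = Poly_Mapping.single (\<Sum>l \<in> S. - full_expo d l) (base_const (qpow k))"
    by blast+
qed

definition is_monopole :: "'v dop \<Rightarrow> bool" where
  "is_monopole A \<longleftrightarrow> (\<exists>k. \<exists>(n, f) \<in> monopole_data G d.
     A = d_scale (qq powi k) (E_op G d n f) \<or> A = d_scale (qq powi k) (F_op G d n f))"

text \<open>The power of \<open>q\<close> is the one allowed in front of a monopole operator; the sign becomes part of the dressing.\<close>

lemma q_unitE:
  assumes "q_unit (u :: 'v wfrac)"
  obtains s k where "s \<noteq> (0::int)" "u = qq powi k * base_const (Poly_Mapping.single 0 s)"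
proof -
  have one: "base_const (Poly_Mapping.single 0 1) = (1 :: 'v wfrac)" "base_const (Poly_Mapping.single 0 (- 1)) = (- 1 :: 'v wfrac)"
    using base_const_minus[of 1] by (simp_all add: single_uminus)
  from assms obtain k where "u = qq powi k \<or> u = - (qq powi k)" by (auto simp: q_unit_def)
  then show ?thesis using that[of 1 k] that[of "- 1" k] by (auto simp: one)
qed

lemma one_in_dressings [simp]: "1 \<in> dressings D n"
  using inverse_block_in_dressings[of "{}" D n 1] by (simp add: inverse_block_def)

lemma block_dressings:
  assumes "n \<le> D"
  shows "inverse_block (if b then {1..n} else {}) s \<in> dressings D n"
    "inverse_block (if b then {n<..D} else {}) s \<in> dressings D n"
proof -
  have "\<pi> ` {n<..D} = {n<..D}" if "\<pi> permutes {1..D}" "\<pi> ` {1..n} = {1..n}" for \<pi>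
  proof -
    have "{n<..D} = {1..D} - {1..n}" by auto
    then show ?thesis
      using that permutes_image[OF that(1)] by (simp add: image_set_diff[OF permutes_inj[OF that(1)]])
  qed
  then show "inverse_block (if b then {n<..D} else {}) s \<in> dressings D n"
    by (intro inverse_block_in_dressings) auto
  show "inverse_block (if b then {1..n} else {}) s \<in> dressings D n"
    using assms by (intro inverse_block_in_dressings) auto
qed

lemma dressing_value_const:
  "s \<noteq> 0 \<Longrightarrow> dressing_value d l J (inverse_block {} s) = base_const (Poly_Mapping.single 0 s)"
  using dressing_value_inverse_block[of "{}" s d l J] by simp

lemma monopole_dataI:
  assumes "i \<in> verts G" "m \<le> d i" "g \<in> dressings (d i) m" "S \<subseteq> verts G"
  shows "(one_active_rank d i S m, \<lambda>l. if l = i then g else 1) \<in> monopole_data G d"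
  using assms by (auto simp: monopole_data_def one_active_rank_def)

text \<open>The sum over \<open>J\<close> that describes the image at the active node is the sum over \<open>J\<close> in \<open>E_op\<close>, and the
  inverse variables outside \<open>J\<close> are the second block of the dressing.\<close>

lemma WG_positive_vector:
  fixes b :: bool
  assumes i: "i \<in> verts G" "m \<le> d i" and S: "S \<subseteq> verts G - {i}"
    and arcs: "\<And>a. a \<in> arcs G \<Longrightarrow> one_active_rank d i S m (tail G a) = 0 \<or>
      one_active_rank d i S m (head G a) = d (head G a)"
  defines "\<xi> \<equiv> node_base d i b m + (\<Sum>l \<in> S. x_fund l (d l))"
  shows "is_monopole (WG (Y \<xi>))"
proof -
  interpret N: node_isomorphism d i "W i" by (rule node[OF i(1)])
  have S': "S \<subseteq> verts G" using S by auto
  obtain u where u: "q_unit u"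
    "W i (Y (node_base d i b m)) = shifted_monopole d i m (\<lambda>J. u * N.dressing_factor b J) 0"
    using N.W_node_base[OF i(2)] by metis
  obtain k where k: "WG (Y (\<Sum>l \<in> S. x_fund l (d l))) = Poly_Mapping.single (\<Sum>l \<in> S. full_expo d l) (base_const (qpow k))"
    using WG_full_shift(3)[OF S'] by blast
  have base: "node_base d i b m \<in> lattice {i} d" "Y (node_base d i b m) \<in> node_laurent d i"
    using node_base_in_lattice[of m d i "{i}" b] node_elements(1)[of m d i b] i(2) by auto
  have "WG (Y \<xi>) = d_mult (WG (Y (node_base d i b m))) (WG (Y (\<Sum>l \<in> S. x_fund l (d l))))"
    unfolding \<xi>_def
    by (rule Y_add_disjoint(2)[OF base(1) WG_full_shift(1)[OF S'] _ node_laurent_subset[OF i(1) base(2)] WG_full_shift(2)[OF S']])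
       (use S in auto)
  then have W\<xi>: "WG (Y \<xi>) = shifted_monopole d i m (\<lambda>J. (base_const (qpow k) * u) * N.dressing_factor b J) (\<Sum>l \<in> S. full_expo d l)"
    unfolding WG_node[OF i(1) base(2)] u(2) k d_mult_shifted_monopole_const by (simp add: mult.assoc)
  have "q_unit (base_const (qpow k) * u)" using u(1) by (simp add: base_const_qpow q_unit_mult)
  then obtain s j where s: "s \<noteq> 0" "base_const (qpow k) * u = qq powi j * base_const (Poly_Mapping.single 0 s)"
    by (rule q_unitE)
  let ?g = "inverse_block (if b then {m<..d i} else {}) s"
  have "WG (Y \<xi>) = shifted_monopole d i m (\<lambda>J. qq powi j * dressing_value d i J ?g) (\<Sum>l \<in> S. full_expo d l)"
    unfolding W\<xi> s(2)
  proof (rule shifted_monopole_cong)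
    fix J assume "J \<subseteq> {1..d i}" "card J = m"
    then show "qq powi j * base_const (Poly_Mapping.single 0 s) * N.dressing_factor b J = qq powi j * dressing_value d i J ?g"
      using dressing_value_second_block[of J d i m s] s(1) by (simp add: dressing_value_const)
  qed
  also have "\<dots> = d_scale (qq powi j) (shifted_monopole d i m (\<lambda>J. dressing_value d i J ?g) (\<Sum>l \<in> S. full_expo d l))"
    by (simp add: d_scale_shifted_monopole)
  also have "shifted_monopole d i m (\<lambda>J. dressing_value d i J ?g) (\<Sum>l \<in> S. full_expo d l) =
      E_op G d (one_active_rank d i S m) (\<lambda>l. if l = i then ?g else 1)"
    unfolding shifted_monopole_def
    by (subst E_op_one_active[OF wf_digraph_axioms finite_verts i(1) S], erule arcs, simp add: divide_inverse mult.commute)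
  finally show ?thesis
    unfolding is_monopole_def using monopole_dataI[OF i block_dressings(2)[OF i(2)] S'] by blast
qed

text \<open>The image at the active node is again a sum over subsets \<open>J\<close> of size \<open>m\<close>, but followed by the inverse of
  the shift in all variables. In terms of the complement of \<open>J\<close> this is an inverse shift, the two
  indices of each rational factor are exchanged as they should be in \<open>F_op\<close>, and the inverse
  variables outside \<open>J\<close> become the first block of the dressing.\<close>

lemma WG_negative_vector:
  fixes b :: bool
  assumes i: "i \<in> verts G" "m \<le> d i" and S: "S \<subseteq> verts G - {i}"
    and arcs: "\<And>a. a \<in> arcs G \<Longrightarrow> one_active_rank d i S (d i - m) (head G a) = 0 \<or>
      one_active_rank d i S (d i - m) (tail G a) = d (tail G a)"
  defines "\<xi> \<equiv> node_base d i b m - x_fund i (d i) + (\<Sum>l \<in> S. - x_fund l (d l))"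
  shows "is_monopole (WG (Y \<xi>))"
proof -
  interpret N: node_isomorphism d i "W i" by (rule node[OF i(1)])
  have S': "S \<subseteq> verts G" using S by auto
  let ?\<kappa> = "node_base d i b m - x_fund i (d i)"
  obtain u where u: "q_unit u"
    "W i (Y ?\<kappa>) = shifted_monopole d i m (\<lambda>J. u * N.dressing_factor b J) (- full_expo d i)"
    using N.W_node_base_minus_x[OF i(2)] by metis
  obtain k where k: "WG (Y (\<Sum>l \<in> S. - x_fund l (d l))) = Poly_Mapping.single (\<Sum>l \<in> S. - full_expo d l) (base_const (qpow k))"
    using WG_full_shift(6)[OF S'] by blast
  have base: "?\<kappa> \<in> lattice {i} d" "Y ?\<kappa> \<in> node_laurent d i"
    using node_base_in_lattice[of m d i "{i}" b] node_elements(2)[of m d i b] i(2) by (auto intro: lattice_closed fund_in_lattice)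
  have "WG (Y \<xi>) = d_mult (WG (Y ?\<kappa>)) (WG (Y (\<Sum>l \<in> S. - x_fund l (d l))))"
    unfolding \<xi>_def
    by (rule Y_add_disjoint(2)[OF base(1) WG_full_shift(4)[OF S'] _ node_laurent_subset[OF i(1) base(2)] WG_full_shift(5)[OF S']])
       (use S in auto)
  then have W\<xi>: "WG (Y \<xi>) = shifted_monopole d i m (\<lambda>J. (base_const (qpow k) * u) * N.dressing_factor b J)
      (- full_expo d i + (\<Sum>l \<in> S. - full_expo d l))"
    unfolding WG_node[OF i(1) base(2)] u(2) k d_mult_shifted_monopole_const by (simp add: mult.assoc)
  have "q_unit (base_const (qpow k) * u)" using u(1) by (simp add: base_const_qpow q_unit_mult)
  then obtain s j where s: "s \<noteq> 0" "base_const (qpow k) * u = qq powi j * base_const (Poly_Mapping.single 0 s)"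
    by (rule q_unitE)
  let ?g = "inverse_block (if b then {1..d i - m} else {}) s"
  let ?n = "one_active_rank d i S (d i - m)" and ?f = "\<lambda>l. if l = i then ?g else 1"
  let ?h = "\<lambda>J. base_const (Poly_Mapping.single 0 s) * N.dressing_factor b J" and
    ?\<nu> = "- full_expo d i + (\<Sum>l \<in> S. - full_expo d l)"
  have card_compl: "card ({1..d i} - J) = d i - card J" if "J \<subseteq> {1..d i}" for J
    using that finite_subset[OF that] by (simp add: card_Diff_subset)
  have "shifted_monopole d i m ?h ?\<nu> = (\<Sum>J | J \<subseteq> {1..d i} \<and> card J = d i - m.
       Poly_Mapping.single (- ((\<Sum>r \<in> J. frag_of (i, r)) + (\<Sum>l \<in> S. full_expo d l)))
         (dressing_value d i J ?g * (\<Prod>r \<in> J. \<Prod>s \<in> {1..d i} - J. 1 / (1 - w i r * inverse (w i s)))))"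
    unfolding shifted_monopole_def
  proof (rule sum.reindex_bij_witness[of _ "\<lambda>J. {1..d i} - J" "\<lambda>J. {1..d i} - J"], goal_cases)
    case (5 J)
    let ?J = "{1..d i} - J"
    have J: "J \<subseteq> {1..d i}" "card J = m" "finite J" using 5 finite_subset by auto
    have compl: "?J \<subseteq> {1..d i}" "card ?J = d i - m" "{1..d i} - ?J = J"
      using J card_compl by auto
    have "(\<Sum>r \<in> J. frag_of (i, r)) + (\<Sum>r \<in> ?J. frag_of (i, r)) = full_expo d i"
      unfolding full_expo_def using sum.subset_diff[OF J(1), of "\<lambda>r. frag_of (i, r)"] by (simp add: add.commute)
    then have expo: "- ((\<Sum>r \<in> ?J. frag_of (i, r)) + (\<Sum>l \<in> S. full_expo d l)) =
        (\<Sum>r \<in> J. frag_of (i, r)) + (- full_expo d i + (\<Sum>l \<in> S. - full_expo d l))"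
      by (simp add: sum_negf algebra_simps)
    have coeff: "dressing_value d i ?J ?g * (\<Prod>r \<in> ?J. \<Prod>s \<in> {1..d i} - ?J. 1 / (1 - w i r * inverse (w i s))) =
        (\<Prod>r \<in> J. \<Prod>s \<in> ?J. 1 / (1 - w i s / w i r)) * (base_const (Poly_Mapping.single 0 s) * N.dressing_factor b J)"
      unfolding compl(3) using dressing_value_first_block[of ?J d i "d i - m" s] compl(1,2) s(1) dressing_value_const[OF s(1)]
      by (subst prod.swap) (simp add: divide_inverse mult.commute)
    show ?case unfolding expo coeff ..
  qed (use i(2) card_compl in \<open>auto simp: double_diff\<close>)
  also have "\<dots> = F_op G d ?n ?f"
    by (subst F_op_one_active[OF wf_digraph_axioms finite_verts i(1) S], erule arcs, rule refl)
  finally have "WG (Y \<xi>) = d_scale (qq powi j) (F_op G d ?n ?f)"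
    unfolding W\<xi> s(2) mult.assoc d_scale_shifted_monopole[where c = "qq powi j", symmetric] by (rule arg_cong)
  moreover have "(?n, ?f) \<in> monopole_data G d"
    using block_dressings(1) by (intro monopole_dataI[OF i(1) _ _ S']) auto
  ultimately show ?thesis
    unfolding is_monopole_def by blast
qed

lemma Y_in_quiver_laurent:
  assumes "\<kappa> \<in> lattice (verts G) d"
    and "\<And>i r. i \<in> verts G \<Longrightarrow> 1 \<le> r \<Longrightarrow> r < d i \<Longrightarrow> form (e_s i r) \<kappa> \<in> {0, 1} \<and> form (e_t i r) \<kappa> \<in> {0, 1}"
    and "\<And>a. a \<in> arcs G \<Longrightarrow> form (e_arrow G d a) \<kappa> \<in> {0, 1}"
  shows "Y \<kappa> \<in> quiver_laurent G d"
  unfolding quiver_laurent_def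
proof (rule Y_in_univ_laurent)
  have "e_arrow G d a \<in> lattice (verts G) d" if "a \<in> arcs G" for a
    using dims that unfolding e_arrow_def by (intro lattice_closed generators_in_lattice) auto
  then show "seed G d \<subseteq> lattice (verts G) d"
    using node_seed_in_lattice[of _ "verts G" d] unfolding seed_def by blast
  fix e assume "e \<in> seed G d"
  then consider i r where "i \<in> verts G" "1 \<le> r" "r < d i" "e = e_s i r \<or> e = e_t i r" | a where "a \<in> arcs G" "e = e_arrow G d a"
    by (auto simp: seed_def node_seed_def)
  then show "form e \<kappa> = 0 \<or> form e \<kappa> = 1"
    by cases (use assms(2,3) in blast)+
qed (rule assms(1))

lemma lookup_full_shift:
  assumes "finite S"
  shows "Poly_Mapping.lookup (\<Sum>l \<in> S. x_fund l (d l)) (X j r) = (if j \<in> S \<and> 1 \<le> r \<and> r \<le> d j then 1 else 0)"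
    "Poly_Mapping.lookup (\<Sum>l \<in> S. x_fund l (d l)) (P j r) = 0"
proof -
  have "Poly_Mapping.lookup (\<Sum>l \<in> S. x_fund l (d l)) (X j r) = (\<Sum>l \<in> S. if l = j then (if 1 \<le> r \<and> r \<le> d j then 1 else 0) else 0)"
    unfolding lookup_sum by (intro sum.cong) (auto simp: lookup_x_fund)
  then show "Poly_Mapping.lookup (\<Sum>l \<in> S. x_fund l (d l)) (X j r) = (if j \<in> S \<and> 1 \<le> r \<and> r \<le> d j then 1 else 0)"
    using assms by simp
qed (simp add: lookup_sum lookup_x_fund)

text \<open>The \<open>x\<close>-coefficients are \<open>0\<close> or \<open>1\<close> and weakly decrease at each node. At an arrow, the assumption excludes
  that the coefficient at the first index of the tail exceeds the one at the last index of the head.\<close>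

lemma Y_positive_vector:
  assumes i: "i \<in> verts G" "m \<le> d i" and S: "S \<subseteq> verts G - {i}"
    and arcs: "\<And>a. a \<in> arcs G \<Longrightarrow> one_active_rank d i S m (tail G a) = 0 \<or>
      one_active_rank d i S m (head G a) = d (head G a)"
  shows "Y (node_base d i b m + (\<Sum>l \<in> S. x_fund l (d l))) \<in> quiver_laurent G d"
proof (rule Y_in_quiver_laurent)
  have fin: "finite S" using S finite_verts finite_subset by blast
  show "node_base d i b m + (\<Sum>l \<in> S. x_fund l (d l)) \<in> lattice (verts G) d"
    using i S by (intro lattice_closed node_base_in_lattice lattice_sum fund_in_lattice) auto
  note lookups = lookup_add lookup_node_base lookup_full_shift[OF fin]
  show "form (e_s j r) (node_base d i b m + (\<Sum>l \<in> S. x_fund l (d l))) \<in> {0, 1} \<and>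
      form (e_t j r) (node_base d i b m + (\<Sum>l \<in> S. x_fund l (d l))) \<in> {0, 1}"
    if "j \<in> verts G" "1 \<le> r" "r < d j" for j r
    using that i unfolding form_e_s form_e_t by (auto simp: lookups)
  show "form (e_arrow G d a) (node_base d i b m + (\<Sum>l \<in> S. x_fund l (d l))) \<in> {0, 1}" if "a \<in> arcs G" for a
    using arcs[OF that] dims[OF tail_in_verts[OF that]] dims[OF head_in_verts[OF that]] i S
    unfolding form_e_arrow by (auto simp: lookups one_active_rank_def split: if_splits)
qed

text \<open>Here the \<open>x\<close>-coefficients are \<open>0\<close> or \<open>- 1\<close>; the first one of a node is \<open>- 1\<close> exactly at full rank and the
  last one is \<open>- 1\<close> exactly at positive rank.\<close>

lemma Y_negative_vector:
  assumes i: "i \<in> verts G" "m \<le> d i" and S: "S \<subseteq> verts G - {i}"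
    and arcs: "\<And>a. a \<in> arcs G \<Longrightarrow> one_active_rank d i S (d i - m) (head G a) = 0 \<or>
      one_active_rank d i S (d i - m) (tail G a) = d (tail G a)"
  shows "Y (node_base d i b m - x_fund i (d i) + (\<Sum>l \<in> S. - x_fund l (d l))) \<in> quiver_laurent G d"
proof (rule Y_in_quiver_laurent)
  have fin: "finite S" using S finite_verts finite_subset by blast
  show "node_base d i b m - x_fund i (d i) + (\<Sum>l \<in> S. - x_fund l (d l)) \<in> lattice (verts G) d"
    using i S by (intro lattice_closed node_base_in_lattice lattice_sum fund_in_lattice) auto
  note lookups = lookup_add lookup_minus lookup_uminus sum_negf lookup_node_base lookup_x_fund lookup_full_shift[OF fin]
  show "form (e_s j r) (node_base d i b m - x_fund i (d i) + (\<Sum>l \<in> S. - x_fund l (d l))) \<in> {0, 1} \<and>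
      form (e_t j r) (node_base d i b m - x_fund i (d i) + (\<Sum>l \<in> S. - x_fund l (d l))) \<in> {0, 1}"
    if "j \<in> verts G" "1 \<le> r" "r < d j" for j r
    using that i unfolding form_e_s form_e_t by (auto simp: lookups)
  show "form (e_arrow G d a) (node_base d i b m - x_fund i (d i) + (\<Sum>l \<in> S. - x_fund l (d l))) \<in> {0, 1}" if "a \<in> arcs G" for a
    using arcs[OF that] dims[OF tail_in_verts[OF that]] dims[OF head_in_verts[OF that]] i S
    unfolding form_e_arrow by (auto simp: lookups one_active_rank_def split: if_splits)
qed

lemma scalar_in_coulomb_branch: "Poly_Mapping.single 0 (base_const c) \<in> coulomb_branch G d"
proof -
  have "Poly_Mapping.single 0 c \<in> symmetric_wlaurents G d"
    by (auto simp: symmetric_wlaurents_def wlaurents_in_def permute_wlaurent_def wsubst_def permute_expo_def split: if_splits)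
  then show ?thesis
    unfolding coulomb_branch_def base_const_def by (intro generate_ring.incl) auto
qed

lemma monopole_in_coulomb_branch:
  assumes "is_monopole A"
  shows "A \<in> coulomb_branch G d"
proof -
  obtain k n f where nf: "(n, f) \<in> monopole_data G d"
    "A = d_scale (qq powi k) (E_op G d n f) \<or> A = d_scale (qq powi k) (F_op G d n f)"
    using assms unfolding is_monopole_def by auto
  have "E_op G d n f \<in> coulomb_branch G d" "F_op G d n f \<in> coulomb_branch G d"
    using nf(1) unfolding coulomb_branch_def by (intro generate_ring.incl; force)+
  moreover have "d_scale (qq powi k) B \<in> coulomb_branch G d" if "B \<in> coulomb_branch G d" for B
  proof -
    have "d_scale (qq powi k) B = d_mult (Poly_Mapping.single 0 (base_const (qpow k))) B"
      by (rule poly_mapping_eqI) (simp add: lookup_d_mult_function base_const_qpow)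
    moreover have "d_mult (Poly_Mapping.single 0 (base_const (qpow k))) B \<in> coulomb_branch G d"
      using generate_ring.eng_mult[OF scalar_in_coulomb_branch[unfolded coulomb_branch_def] that[unfolded coulomb_branch_def]]
      by (simp add: coulomb_branch_def dops_def)
    ultimately show ?thesis by simp
  qed
  ultimately show ?thesis using nf(2) by auto
qed

definition monopole_vector :: "'v lat \<Rightarrow> bool" where
  "monopole_vector \<xi> \<longleftrightarrow> Y \<xi> \<in> quiver_laurent G d \<and> is_monopole (WG (Y \<xi>))"

end

section \<open>The dual basis of a forest quiver\<close>

locale forest_isomorphism = forest_quiver G R + quiver_isomorphism G d W WG
  for G :: "('v::linorder, 'a) pre_digraph" and R d W WG
begin

lemma monopole_vector_positive:
  assumes "i \<in> verts G" "m \<le> d i" "S \<subseteq> verts G - {i}"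
    and "\<And>a. a \<in> arcs G \<Longrightarrow> tail G a \<in> S \<or> tail G a = i \<and> m > 0 \<Longrightarrow>
      head G a \<in> S \<or> head G a = i \<and> m = d i"
  shows "monopole_vector (node_base d i b m + (\<Sum>l \<in> S. x_fund l (d l)))"
proof -
  have "one_active_rank d i S m (tail G a) = 0 \<or> one_active_rank d i S m (head G a) = d (head G a)"
    if "a \<in> arcs G" for a
    using assms(3) that by (cases "m = 0") (auto simp: one_active_rank_def dest: assms(4))
  then show ?thesis
    unfolding monopole_vector_def using WG_positive_vector Y_positive_vector assms(1-3) by blast
qed

lemma monopole_vector_negative:
  assumes "i \<in> verts G" "m \<le> d i" "S \<subseteq> verts G - {i}"
    and "\<And>a. a \<in> arcs G \<Longrightarrow> head G a \<in> S \<or> head G a = i \<and> m < d i \<Longrightarrow>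
      tail G a \<in> S \<or> tail G a = i \<and> m = 0"
  shows "monopole_vector (node_base d i b m - x_fund i (d i) + (\<Sum>l \<in> S. - x_fund l (d l)))"
proof -
  have "one_active_rank d i S (d i - m) (head G a) = 0 \<or> one_active_rank d i S (d i - m) (tail G a) = d (tail G a)"
    if "a \<in> arcs G" for a
    using assms(2,3) that by (cases "m = d i") (auto simp: one_active_rank_def dest: assms(4))
  then show ?thesis
    unfolding monopole_vector_def using WG_negative_vector Y_negative_vector assms(1-3) by blast
qed

lemma parent_arc_downward:
  assumes "a \<in> arcs G"
  shows "parent_of G R (tail G a) (head G a) \<longleftrightarrow> downward (a, True)"
proof
  assume "parent_of G R (tail G a) (head G a)"
  then obtain e where e: "downward e" "tail U e = tail G a" "head U e = head G a"
    unfolding parent_of_iff by blast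
  then have "length (root_path (head G a)) = length (root_path (tail G a)) + 1"
    by (metis downward_def length_append_singleton Suc_eq_plus1)
  moreover have "length (root_path (tail G a)) = length (root_path (head G a)) + 1" if "downward (rev_arc (a, True))"
    using that unfolding downward_def by simp
  ultimately show "downward (a, True)"
    using downward_or_reverse[of "(a, True)"] assms by auto
next
  assume "downward (a, True)"
  then show "parent_of G R (tail G a) (head G a)" unfolding parent_of_iff by (intro exI[of _ "(a, True)"]) auto
qed

text \<open>Every arrow of a rooted forest joins a parent and a child, so it points upwards if it does not point
  downwards.\<close>

lemma not_parent_arc_downward:
  assumes "a \<in> arcs G" "\<not> parent_of G R (tail G a) (head G a)"
  shows "downward (a, False)"
  using downward_or_reverse[of "(a, True)"] assms parent_arc_downward by (auto simp: rev_arc_def)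

text \<open>The union of the subtrees whose topmost node is reached from \<open>i\<close> along an arrow, traversed forwards for
  \<open>b = True\<close> and backwards for \<open>b = False\<close>.\<close>

definition branches :: "bool \<Rightarrow> 'v \<Rightarrow> 'v set" where
  "branches b i = (\<Union>e \<in> {e \<in> arcs G \<times> {b}. tail U e = i}. descendants G R (head U e))"

text \<open>If all arrows of the given direction at \<open>i\<close> lead down, these subtrees are disjoint. An arrow of the same
  direction that starts in one of them stays there, because the only exit is an arrow of the
  opposite direction.\<close>

lemma branches_properties:
  assumes "i \<in> verts G" and down: "\<And>e. e \<in> arcs G \<times> {b} \<Longrightarrow> tail U e = i \<Longrightarrow> downward e"
  shows "branches b i \<subseteq> verts G - {i}"
    and "(\<Sum>e \<in> {e \<in> arcs G \<times> {b}. tail U e = i}. x_desc G d R (head U e)) = (\<Sum>l \<in> branches b i. x_fund l (d l))"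
    and "\<And>e. e \<in> arcs G \<times> {b} \<Longrightarrow> tail U e \<in> branches b i \<or> tail U e = i \<Longrightarrow> head U e \<in> branches b i"
proof -
  let ?A = "{e \<in> arcs G \<times> {b}. tail U e = i}"
  show "branches b i \<subseteq> verts G - {i}"
    using descendants_subset tail_not_in_subtree down unfolding branches_def by blast
  have "finite ?A" by (rule finite_subset[of _ "arcs G \<times> {b}"]) auto
  moreover have "\<forall>e \<in> ?A. finite (descendants G R (head U e))"
    using finite_subset_verts descendants_subset by blast
  moreover have "\<forall>e \<in> ?A. \<forall>f \<in> ?A. e \<noteq> f \<longrightarrow> descendants G R (head U e) \<inter> descendants G R (head U f) = {}"
    using disjoint_subtrees down by fastforce
  ultimately show "(\<Sum>e \<in> ?A. x_desc G d R (head U e)) = (\<Sum>l \<in> branches b i. x_fund l (d l))"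
    unfolding branches_def x_desc_def by (rule sum.UNION_disjoint[symmetric])
  fix e assume e: "e \<in> arcs G \<times> {b}" and t: "tail U e \<in> branches b i \<or> tail U e = i"
  from t show "head U e \<in> branches b i"
  proof
    assume "tail U e = i"
    moreover have "head U e \<in> verts G" using U.head_in_verts[of e] e by auto
    ultimately show ?thesis using e self_descendant unfolding branches_def by blast
  next
    assume "tail U e \<in> branches b i"
    then obtain f where f: "f \<in> arcs G \<times> {b}" "tail U f = i" "tail U e \<in> descendants G R (head U f)"
      unfolding branches_def by blast
    moreover have "e \<noteq> rev_arc f" using e f(1) by (auto simp: rev_arc_def)
    ultimately have "head U e \<in> descendants G R (head U f)"
      using subtree_arc_closed[of f e] down e by auto
    then show ?thesis using f unfolding branches_def by blast
  qed
qed

text \<open>The sign of \<open>i\<close> is chosen such that the arrow between \<open>i\<close> and its parent is not among the arrows that \<open>\<rho>\<close>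
  runs over: for sign \<open>1\<close> it points to \<open>i\<close> (or does not exist) and \<open>\<rho>\<close> uses the outgoing arrows, for sign
  \<open>- 1\<close> it points away from \<open>i\<close> and \<open>\<rho>\<close> uses the incoming ones.\<close>

lemma monopole_vector_rho:
  assumes i: "i \<in> verts G" "m \<le> d i"
  shows "monopole_vector (node_base d i b m + rho G d R i)"
proof (cases "node_sgn G R i = 1")
  case True
  have down: "downward e" if "e \<in> arcs G \<times> {True}" "tail U e = i" for e
  proof (rule ccontr)
    assume "\<not> downward e"
    then have r: "downward (rev_arc e)" using downward_or_reverse[of e] that by auto
    then have path: "root_path i = root_path (head U e) @ [rev_arc e]"
      using that by (simp add: downward_def)
    from True have "i \<in> R \<or> (\<exists>a \<in> in_arcs G i. parent_of G R (tail G a) i)"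
      by (auto simp: node_sgn_def split: if_splits)
    then show False
    proof
      assume "i \<in> R"
      then have "root_path i = []"
        using i(1) by (intro root_path_eqI[of i]) (auto simp: U.apath_Nil_iff)
      then show False using path by simp
    next
      assume "\<exists>a \<in> in_arcs G i. parent_of G R (tail G a) i"
      then obtain a where a: "a \<in> arcs G" "head G a = i" "parent_of G R (tail G a) i" by auto
      then have "downward (a, True)" using parent_arc_downward by auto
      then have "(a, True) = rev_arc e"
        using r that(2) a(2) by (intro downward_head_inj) auto
      then show False using that(1) by (auto simp: rev_arc_def)
    qed
  qed
  have "rho G d R i = (\<Sum>a \<in> out_arcs G i. x_desc G d R (head G a))" using True by (simp add: rho_def)
  also have "\<dots> = (\<Sum>e \<in> {e \<in> arcs G \<times> {True}. tail U e = i}. x_desc G d R (head U e))"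
    by (rule sum.reindex_bij_witness[of _ fst "\<lambda>a. (a, True)"]) auto
  finally have "rho G d R i = (\<Sum>l \<in> branches True i. x_fund l (d l))"
    using branches_properties(2)[OF i(1) down] by simp
  moreover have "monopole_vector (node_base d i b m + (\<Sum>l \<in> branches True i. x_fund l (d l)))"
  proof (rule monopole_vector_positive[OF i])
    show "branches True i \<subseteq> verts G - {i}" using branches_properties(1)[OF i(1) down] .
    fix a assume "a \<in> arcs G" "tail G a \<in> branches True i \<or> tail G a = i \<and> 0 < m"
    then show "head G a \<in> branches True i \<or> head G a = i \<and> m = d i"
      using branches_properties(3)[OF i(1) down, where e = "(a, True)"] by auto
  qed
  ultimately show ?thesis by simp
next
  case False
  have down: "downward e" if e: "e \<in> arcs G \<times> {False}" "tail U e = i" for e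
  proof -
    obtain a where a: "e = (a, False)" "a \<in> in_arcs G i" using e by (cases e) auto
    then have "\<not> parent_of G R (tail G a) (head G a)"
      using False by (auto simp: node_sgn_def split: if_splits)
    then show ?thesis using not_parent_arc_downward a by auto
  qed
  have "rho G d R i = - x_fund i (d i) - (\<Sum>a \<in> in_arcs G i. x_desc G d R (tail G a))" using False by (simp add: rho_def)
  also have "(\<Sum>a \<in> in_arcs G i. x_desc G d R (tail G a)) = (\<Sum>e \<in> {e \<in> arcs G \<times> {False}. tail U e = i}. x_desc G d R (head U e))"
    by (rule sum.reindex_bij_witness[of _ fst "\<lambda>a. (a, False)"]) auto
  finally have "rho G d R i = - x_fund i (d i) + (\<Sum>l \<in> branches False i. - x_fund l (d l))"
    using branches_properties(2)[OF i(1) down] by (simp add: sum_negf)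
  moreover have "monopole_vector (node_base d i b m - x_fund i (d i) + (\<Sum>l \<in> branches False i. - x_fund l (d l)))"
  proof (rule monopole_vector_negative[OF i])
    show "branches False i \<subseteq> verts G - {i}" using branches_properties(1)[OF i(1) down] .
    fix a assume "a \<in> arcs G" "head G a \<in> branches False i \<or> head G a = i \<and> m < d i"
    then show "tail G a \<in> branches False i \<or> tail G a = i \<and> m = 0"
      using branches_properties(3)[OF i(1) down, where e = "(a, False)"] by auto
  qed
  ultimately show ?thesis by (simp only: diff_conv_add_uminus add.assoc)
qed

lemma monopole_vector_node: "i \<in> verts G \<Longrightarrow> monopole_vector (xi_node d i)"
  using monopole_vector_positive[of i 0 "{}" True] by (simp add: node_base_def xi_node_def)

lemma full_sum:
  assumes "S \<subseteq> verts G" "i \<in> S"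
  shows "(\<Sum>l \<in> S. x_fund l (d l)) = x_fund i (d i) + (\<Sum>l \<in> S - {i}. x_fund l (d l))"
  using assms finite_subset_verts by (intro sum.remove) auto

text \<open>Any node of the component may serve as the active one, with \<open>m\<close> equal to its dimension; no arrow
  leaves a component.\<close>

lemma monopole_vector_component:
  assumes "i \<in> verts G"
  shows "monopole_vector (xi_comp d (component_of G i))"
proof -
  let ?C = "component_of G i"
  have "monopole_vector (node_base d i False (d i) + (\<Sum>l \<in> ?C - {i}. x_fund l (d l)))"
    by (rule monopole_vector_positive)
       (use assms component_subset component_arc_closed[of _ i] self_in_component[OF assms] in auto)
  then show ?thesis
    using full_sum[OF component_subset self_in_component[OF assms]] by (simp add: xi_comp_def node_base_def)
qed

text \<open>The subtree below the arrow is taken with full rank, its topmost node being the active one: with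
  \<open>m = d i\<close> for the positive sign and \<open>m = 0\<close> for the negative sign. The arrow itself is the only connection
  with the rest and points into the subtree, respectively out of it.\<close>

lemma monopole_vector_arrow:
  assumes a: "a \<in> arcs G"
  shows "monopole_vector (xi_arrow G d R a)"
proof (cases "arrow_sgn G R a = 1")
  case True
  then have down: "downward (a, True)"
    using parent_arc_downward[OF a] by (auto simp: arrow_sgn_def split: if_splits)
  let ?j = "head G a" and ?S = "descendants G R (head G a)"
  have j: "?j \<in> verts G" "?j \<in> ?S" using a self_descendant by auto
  have closed: "head G c \<in> ?S" if "c \<in> arcs G" "tail G c \<in> ?S" for c
    using subtree_arc_closed[OF down, of "(c, True)"] that by (simp add: rev_arc_def)
  have "monopole_vector (node_base d ?j False (d ?j) + (\<Sum>l \<in> ?S - {?j}. x_fund l (d l)))"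
    by (rule monopole_vector_positive) (use j descendants_subset closed in auto)
  then show ?thesis
    using full_sum[OF descendants_subset j(2)] True by (simp add: xi_arrow_def x_desc_def node_base_def)
next
  case False
  then have down: "downward (a, False)"
    using not_parent_arc_downward[OF a] by (auto simp: arrow_sgn_def split: if_splits)
  let ?j = "tail G a" and ?S = "descendants G R (tail G a)"
  have j: "?j \<in> verts G" "?j \<in> ?S" using a self_descendant by auto
  have closed: "tail G c \<in> ?S" if "c \<in> arcs G" "head G c \<in> ?S" for c
    using subtree_arc_closed[OF down, of "(c, False)"] that by (simp add: rev_arc_def)
  have "monopole_vector (node_base d ?j False 0 - x_fund ?j (d ?j) + (\<Sum>l \<in> ?S - {?j}. - x_fund l (d l)))"
    by (rule monopole_vector_negative) (use j descendants_subset closed in auto)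
  then show ?thesis
    using full_sum[OF descendants_subset j(2)] False by (simp add: xi_arrow_def x_desc_def node_base_def sum_negf)
qed

lemma dual_seed_monopole_vector:
  assumes "\<xi> \<in> dual_seed G d R"
  shows "monopole_vector \<xi>"
proof -
  have "monopole_vector (xi_t G d R i m)" "monopole_vector (xi_s G d R i m)"
    if "i \<in> verts G" "m < d i" for i m
    using monopole_vector_rho[of i m False] monopole_vector_rho[of i m True] that
    by (simp_all add: node_base_def xi_t_def xi_s_def algebra_simps)
  then show ?thesis
    using assms monopole_vector_node monopole_vector_component monopole_vector_arrow
    unfolding dual_seed_def by auto
qed

end

theorem corollary7p2:
  fixes \<Gamma> :: "('v::linorder, 'a) pre_digraph"
    and d :: "'v \<Rightarrow> nat"
    and R :: "'v set"
    and W :: "'v \<Rightarrow> 'v qtor \<Rightarrow> 'v dop"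
    and W\<^sub>\<Gamma> :: "'v qtor \<Rightarrow> 'v dop"
  assumes "fin_digraph \<Gamma>"
    and "undirected_forest \<Gamma>"
    and "\<And>i. i \<in> verts \<Gamma> \<Longrightarrow> d i \<ge> 1"
    and "root_choice \<Gamma> R"
    and "\<And>i. i \<in> verts \<Gamma> \<Longrightarrow> node_iso d i (W i)"
    and "tensor_map (verts \<Gamma>) d W W\<^sub>\<Gamma>"
  shows "\<forall>\<xi> \<in> dual_seed \<Gamma> d R.
    Y \<xi> \<in> quiver_laurent \<Gamma> d \<and>
    W\<^sub>\<Gamma> (Y \<xi>) \<in> coulomb_branch \<Gamma> d \<and>
    (\<exists>k :: int. \<exists>(n, f) \<in> monopole_data \<Gamma> d.
       W\<^sub>\<Gamma> (Y \<xi>) = d_scale (qq powi k) (E_op \<Gamma> d n f) \<or>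
       W\<^sub>\<Gamma> (Y \<xi>) = d_scale (qq powi k) (F_op \<Gamma> d n f))"
proof -
  interpret forest_isomorphism \<Gamma> R d W W\<^sub>\<Gamma>
    by (intro forest_isomorphism.intro forest_quiver.intro quiver_isomorphism.intro) (use assms in auto)
  show ?thesis
    using dual_seed_monopole_vector monopole_in_coulomb_branch
    unfolding monopole_vector_def is_monopole_def[symmetric] by blast
qed

end
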